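(* There is an algorithm which, given a Sudoku rule $\mathcal{S}$ and an initial condition $\mathcal{C}$, generates in finite time a finite Abelian group $H_1$ and a weakly expressible $(\mathbb{Z}^2\times\mathbb{Z}/2\mathbb{Z},H_1)$-property $P$, together with a system of functional equations witnessing the weak expressibility of $P$, such that the $(\mathcal{S},\mathcal{C})$-Sudoku puzzle is solvable if and only if $P$ is satisfiable.
   Context: Sudoku puzzles: for a natural number $N$ and non-empty finite set $\Sigma$, $\mathbb{B}=\{0,\dots,N-1\}\times\mathbb{Z}$; a Sudoku rule is a set $\mathcal{S}$ of functions $\{0,\dots,N-1\}\to\Sigma$; an $\mathcal{S}$-Sudoku solution is $F:\mathbb{B}\to\Sigma$ with $n\mapsto F(n,jn+i)$ in $\mathcal{S}$ for all $j,i\in\mathbb{Z}$; an initial condition with period $q\ge1$ is $\mathcal{C}\subset(\mathbb{Z}/q\mathbb{Z})\times\Sigma$, and $F$ obeys it if for each $n$ there is a permutation $\sigma_n$ of $\mathbb{Z}/q\mathbb{Z}$ with $(\sigma_n(m\bmod q),F(n,m))\in\mathcal{C}$ for all $m$; the puzzle is solvable if some solution obeys $\mathcal{C}$. Expressibility: for $G$ finitely generated Abelian and $H$ finite Abelian, a $(G,H)$-property is a set $P$ of functions $\alpha:G\to H$, satisfiable if nonempty. It is expressible if there exist $M\in\mathbb{N}$, and for $i=1,\dots,M$ numbers $J_i$, sets $E'_i\subset H$, shifts $h_{i,j}\in G$ and sets $E_{i,j}\subset H$ ($j\le J_i$), such that $\alpha\in P$ iff for all $i$ and $x\in G$ the sets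 $\alpha(x+h_{i,j})+E_{i,j}$ ($j=1,\dots,J_i$) are pairwise disjoint with union $E'_i$. For tuples $(\alpha_u:G\to H_u)_{u\in\mathcal{U}}$ properties are identified with $(G,\prod_uH_u)$-properties. A property $P$ of tuples indexed by $\mathcal{U}$ is weakly expressible if there is an expressible property $P^*$ of tuples indexed by $\mathcal{U}\uplus\mathcal{U}^*$ (with finite Abelian targets) such that a tuple obeys $P$ iff it has an extension obeying $P^*$; the witnessing system is that of $P^*$. *)

theory Defs
  imports "HOL-Algebra.Algebra" "HOL-Library.Nat_Bijection" "HOL-Combinatorics.Permutations"
begin

section \<open>Algorithms\<close>

text \<open>
  The model of computation is that of the partial recursive functions: an algorithm is a term
  built from the usual schemes, acting on finite lists of natural numbers.  The relation
  \<open>yields p xs y\<close> says that \<open>p\<close> halts on input \<open>xs\<close> with output \<open>y\<close>.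
\<close>

datatype algorithm =
    Zero
  | Succ
  | Proj nat
  | Comp algorithm "algorithm list"
  | PrimRec algorithm algorithm
  | Minimize algorithm

inductive yields :: "algorithm \<Rightarrow> nat list \<Rightarrow> nat \<Rightarrow> bool" where
  "yields Zero xs 0"
| "yields Succ [x] (Suc x)"
| "i < length xs \<Longrightarrow> yields (Proj i) xs (xs ! i)"
| "list_all2 (\<lambda>g y. yields g xs y) gs ys \<Longrightarrow> yields f ys z \<Longrightarrow> yields (Comp f gs) xs z"
| "yields f xs y \<Longrightarrow> yields (PrimRec f g) (0 # xs) y"
| "yields (PrimRec f g) (n # xs) r \<Longrightarrow> yields g (n # r # xs) y
    \<Longrightarrow> yields (PrimRec f g) (Suc n # xs) y"
| "yields f (n # xs) 0 \<Longrightarrow> (\<forall>m<n. \<exists>k. yields f (m # xs) (Suc k))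
    \<Longrightarrow> yields (Minimize f) xs n"

inductive_cases yields_cases:
  "yields Zero xs z" "yields Succ xs z" "yields (Proj i) xs z" "yields (Comp f gs) xs z"
  "yields (PrimRec f g) (0 # xs) z" "yields (PrimRec f g) (Suc n # xs) z"
  "yields (Minimize f) xs z"

lemma yields_deterministic: "yields p xs y \<Longrightarrow> yields p xs z \<Longrightarrow> y = z"
proof (induction arbitrary: z rule: yields.induct)
  case (1 xs)
  then show ?case by (rule yields_cases(1)) simp
next
  case (2 x)
  then show ?case by (rule yields_cases(2)) simp
next
  case (3 i xs)
  then show ?case by - (erule yields_cases(3), simp)
next
  case (4 xs gs ys f y)
  from "4.prems" obtain zs where zs: "list_all2 (\<lambda>g y. yields g xs y) gs zs" "yields f zs z"
    by (rule yields_cases(4))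
  have "ys = zs"
    using "4.IH"(1) zs(1) by (auto simp: list_all2_conv_all_nth intro!: nth_equalityI)
  then show ?case using "4.IH"(2) zs(2) by blast
next
  case (5 f xs y g)
  from "5.prems" have "yields f xs z" by (rule yields_cases(5))
  then show ?case by (rule "5.IH")
next
  case (6 f g n xs r y)
  from "6.prems" obtain r' where r': "yields (PrimRec f g) (n # xs) r'" "yields g (n # r' # xs) z"
    by (rule yields_cases(6))
  from "6.IH"(1)[OF r'(1)] r'(2) have "yields g (n # r # xs) z" by simp
  then show ?case by (rule "6.IH"(2))
next
  case (7 f n xs)
  from "7.prems" have z: "yields f (z # xs) 0" "\<forall>m<z. \<exists>k. yields f (m # xs) (Suc k)"
    by (blast elim: yields_cases(7))+
  show ?case
  proof (rule linorder_cases[of n z])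
    assume "n < z"
    with z(2) obtain k where "yields f (n # xs) (Suc k)" by blast
    from "7.IH"(1)[OF this] show ?thesis by simp
  next
    assume "z < n"
    with "7.IH"(2) obtain k where "\<And>w. yields f (z # xs) w \<Longrightarrow> Suc k = w" by blast
    from this[OF z(1)] show ?thesis by simp
  qed
qed


section \<open>Sudoku puzzles\<close>

definition board :: "nat \<Rightarrow> (nat \<times> int) set" where
  "board N = {0..<N} \<times> UNIV"

definition sudoku_rule :: "nat \<Rightarrow> 'a set \<Rightarrow> (nat \<Rightarrow> 'a) set \<Rightarrow> bool" where
  "sudoku_rule N \<Sigma> S \<longleftrightarrow> S \<subseteq> ({0..<N} \<rightarrow>\<^sub>E \<Sigma>)"

definition sudoku_solution ::
    "nat \<Rightarrow> 'a set \<Rightarrow> (nat \<Rightarrow> 'a) set \<Rightarrow> (nat \<times> int \<Rightarrow> 'a) \<Rightarrow> bool" where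
  "sudoku_solution N \<Sigma> S F \<longleftrightarrow>
     F \<in> (board N \<rightarrow>\<^sub>E \<Sigma>) \<and> (\<forall>j i :: int. (\<lambda>n\<in>{0..<N}. F (n, j * int n + i)) \<in> S)"

text \<open>The group of residues modulo \<open>q\<close> is represented by \<open>{0..<int q}\<close>.\<close>

definition initial_condition :: "nat \<Rightarrow> 'a set \<Rightarrow> (int \<times> 'a) set \<Rightarrow> bool" where
  "initial_condition q \<Sigma> C \<longleftrightarrow> q \<ge> 1 \<and> C \<subseteq> {0..<int q} \<times> \<Sigma>"

definition obeys :: "nat \<Rightarrow> nat \<Rightarrow> (int \<times> 'a) set \<Rightarrow> (nat \<times> int \<Rightarrow> 'a) \<Rightarrow> bool" where
  "obeys N q C F \<longleftrightarrow>
     (\<forall>n\<in>{0..<N}. \<exists>\<sigma>. \<sigma> permutes {0..<int q} \<and> (\<forall>m::int. (\<sigma> (m mod int q), F (n, m)) \<in> C))"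

definition sudoku_solvable ::
    "nat \<Rightarrow> 'a set \<Rightarrow> (nat \<Rightarrow> 'a) set \<Rightarrow> nat \<Rightarrow> (int \<times> 'a) set \<Rightarrow> bool" where
  "sudoku_solvable N \<Sigma> S q C \<longleftrightarrow> (\<exists>F. sudoku_solution N \<Sigma> S F \<and> obeys N q C F)"


section \<open>Expressible and weakly expressible properties\<close>

abbreviation finite_abelian :: "('h, 'c) monoid_scheme \<Rightarrow> bool" where
  "finite_abelian H \<equiv> comm_group H \<and> finite (carrier H)"

definition is_property ::
    "('g, 'b) monoid_scheme \<Rightarrow> ('h, 'c) monoid_scheme \<Rightarrow> ('g \<Rightarrow> 'h) set \<Rightarrow> bool" where
  "is_property G H P \<longleftrightarrow> P \<subseteq> (carrier G \<rightarrow>\<^sub>E carrier H)"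

definition satisfiable :: "('g \<Rightarrow> 'h) set \<Rightarrow> bool" where
  "satisfiable P \<longleftrightarrow> P \<noteq> {}"

text \<open>
  The pair \<open>(E', [(h\<^sub>1, E\<^sub>1), \<dots>, (h\<^sub>J, E\<^sub>J)])\<close> stands for the functional equation
  \<open>(\<alpha>(x + h\<^sub>1) + E\<^sub>1) \<uplus> \<dots> \<uplus> (\<alpha>(x + h\<^sub>J) + E\<^sub>J) = E'\<close>, to hold for all \<open>x \<in> G\<close>.
\<close>

type_synonym ('g, 'h) equation = "'h set \<times> ('g \<times> 'h set) list"

definition is_system ::
    "('g, 'b) monoid_scheme \<Rightarrow> ('h, 'c) monoid_scheme \<Rightarrow> ('g, 'h) equation list \<Rightarrow> bool" where
  "is_system G H sys \<longleftrightarrow>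
     (\<forall>(E', ts) \<in> set sys. E' \<subseteq> carrier H \<and>
        (\<forall>(h, E) \<in> set ts. h \<in> carrier G \<and> E \<subseteq> carrier H))"

definition solves_equation ::
    "('g, 'b) monoid_scheme \<Rightarrow> ('h, 'c) monoid_scheme \<Rightarrow> ('g \<Rightarrow> 'h) \<Rightarrow> ('g, 'h) equation \<Rightarrow> bool" where
  "solves_equation G H \<alpha> = (\<lambda>(E', ts). \<forall>x\<in>carrier G.
     let A = (\<lambda>j. \<alpha> (x \<otimes>\<^bsub>G\<^esub> fst (ts ! j)) <#\<^bsub>H\<^esub> snd (ts ! j)) in
       (\<forall>i<length ts. \<forall>j<length ts. i \<noteq> j \<longrightarrow> A i \<inter> A j = {}) \<and>
       (\<Union>j<length ts. A j) = E')"

definition expressed_by ::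
    "('g, 'b) monoid_scheme \<Rightarrow> ('h, 'c) monoid_scheme \<Rightarrow> ('g, 'h) equation list
      \<Rightarrow> ('g \<Rightarrow> 'h) set \<Rightarrow> bool" where
  "expressed_by G H sys P \<longleftrightarrow>
     is_property G H P \<and> is_system G H sys \<and>
     (\<forall>\<alpha> \<in> carrier G \<rightarrow>\<^sub>E carrier H. \<alpha> \<in> P \<longleftrightarrow> (\<forall>e \<in> set sys. solves_equation G H \<alpha> e))"

definition expressible ::
    "('g, 'b) monoid_scheme \<Rightarrow> ('h, 'c) monoid_scheme \<Rightarrow> ('g \<Rightarrow> 'h) set \<Rightarrow> bool" where
  "expressible G H P \<longleftrightarrow> (\<exists>sys. expressed_by G H sys P)"

definition tuples ::
    "('g, 'b) monoid_scheme \<Rightarrow> 'u set \<Rightarrow> ('u \<Rightarrow> 'h monoid) \<Rightarrow> ('u \<Rightarrow> 'g \<Rightarrow> 'h) set" where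
  "tuples G U H = (\<Pi>\<^sub>E u\<in>U. carrier G \<rightarrow>\<^sub>E carrier (H u))"

text \<open>
  Identification of a tuple of functions \<open>\<alpha>\<^sub>u : G \<rightarrow> H\<^sub>u\<close> with a single function from \<open>G\<close> to
  the product of the \<open>H\<^sub>u\<close>.
\<close>

definition joint ::
    "('g, 'b) monoid_scheme \<Rightarrow> 'u set \<Rightarrow> ('u \<Rightarrow> 'g \<Rightarrow> 'h) \<Rightarrow> ('g \<Rightarrow> 'u \<Rightarrow> 'h)" where
  "joint G U \<alpha> = (\<lambda>x\<in>carrier G. \<lambda>u\<in>U. \<alpha> u x)"

text \<open>
  \<open>P\<close> is a property of tuples indexed by \<open>U\<close>, and \<open>Q\<close> is a property of tuples indexed by the
  disjoint union of \<open>U\<close> and \<open>V\<close> whose restrictions to \<open>U\<close> are exactly the members of \<open>P\<close>.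
\<close>

definition lifts_to ::
    "('g, 'b) monoid_scheme \<Rightarrow> 'u set \<Rightarrow> ('u \<Rightarrow> 'h monoid) \<Rightarrow> ('u \<Rightarrow> 'g \<Rightarrow> 'h) set
      \<Rightarrow> 'v set \<Rightarrow> ('v \<Rightarrow> 'h monoid) \<Rightarrow> ('u + 'v \<Rightarrow> 'g \<Rightarrow> 'h) set \<Rightarrow> bool" where
  "lifts_to G U H P V K Q \<longleftrightarrow>
     P \<subseteq> tuples G U H \<and> Q \<subseteq> tuples G (U <+> V) (case_sum H K) \<and>
     (\<forall>\<alpha> \<in> tuples G U H. \<alpha> \<in> P \<longleftrightarrow> (\<exists>\<beta>\<in>Q. \<forall>u\<in>U. \<beta> (Inl u) = \<alpha> u))"

definition weakly_expressed_by ::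
    "('g, 'b) monoid_scheme \<Rightarrow> 'u set \<Rightarrow> ('u \<Rightarrow> 'h monoid) \<Rightarrow> 'v set \<Rightarrow> ('v \<Rightarrow> 'h monoid)
      \<Rightarrow> ('g, 'u + 'v \<Rightarrow> 'h) equation list \<Rightarrow> ('u \<Rightarrow> 'g \<Rightarrow> 'h) set \<Rightarrow> bool" where
  "weakly_expressed_by G U H V K sys P \<longleftrightarrow>
     finite V \<and> (\<forall>v\<in>V. finite_abelian (K v)) \<and>
     (\<exists>Q. lifts_to G U H P V K Q \<and>
          expressed_by G (product_group (U <+> V) (case_sum H K)) sys (joint G (U <+> V) ` Q))"

text \<open>
  The auxiliary index set and the elements of the groups are taken among the natural numbers;
  up to renaming, this covers all finite index sets and all finite groups.
\<close>

definition weakly_expressible ::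
    "('g, 'b) monoid_scheme \<Rightarrow> 'u set \<Rightarrow> ('u \<Rightarrow> nat monoid) \<Rightarrow> ('u \<Rightarrow> 'g \<Rightarrow> nat) set \<Rightarrow> bool" where
  "weakly_expressible G U H P \<longleftrightarrow>
     (\<exists>(V :: nat set) K Q. finite V \<and> (\<forall>v\<in>V. finite_abelian (K v)) \<and> lifts_to G U H P V K Q \<and>
        expressible G (product_group (U <+> V) (case_sum H K)) (joint G (U <+> V) ` Q))"

text \<open>A single function is a tuple indexed by the one-element type \<open>unit\<close>.\<close>

definition singly :: "('g \<Rightarrow> 'h) set \<Rightarrow> (unit \<Rightarrow> 'g \<Rightarrow> 'h) set" where
  "singly P = (\<lambda>\<alpha> _. \<alpha>) ` P"


section \<open>Input and output of the algorithm\<close>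

definition grid_group :: "(int \<times> int \<times> int) monoid" where
  "grid_group = integer_group \<times>\<times> integer_group \<times>\<times> integer_mod_group 2"

text \<open>
  Finite objects are coded by natural numbers by means of the standard bijections; the digits of
  a puzzle and the elements of the finite groups are natural numbers.  All codes below are
  injective: in particular a finite group is coded by the graph of its multiplication, which
  determines its carrier, and the members of an extensional family by the list of its values.
\<close>

definition puzzle_code ::
    "nat \<Rightarrow> nat set \<Rightarrow> (nat \<Rightarrow> nat) set \<Rightarrow> nat \<Rightarrow> (int \<times> nat) set \<Rightarrow> nat list" where
  "puzzle_code N \<Sigma> S q C =
     [N,
      set_encode \<Sigma>,
      set_encode ((\<lambda>f. list_encode (map f [0..<N])) ` S),
      q,
      set_encode ((\<lambda>(i, s). prod_encode (nat i, s)) ` C)]"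

definition group_code :: "nat monoid \<Rightarrow> nat" where
  "group_code H =
     set_encode ((\<lambda>(a, b). prod_encode (a, prod_encode (b, a \<otimes>\<^bsub>H\<^esub> b))) ` (carrier H \<times> carrier H))"

definition shift_code :: "int \<times> int \<times> int \<Rightarrow> nat" where
  "shift_code = (\<lambda>(a, b, c).
     prod_encode (int_encode a, prod_encode (int_encode b, int_encode c)))"

definition element_code :: "nat \<Rightarrow> (unit + nat \<Rightarrow> nat) \<Rightarrow> nat" where
  "element_code n f = list_encode (f (Inl ()) # map (\<lambda>v. f (Inr v)) [0..<n])"

definition equation_code :: "nat \<Rightarrow> (int \<times> int \<times> int, unit + nat \<Rightarrow> nat) equation \<Rightarrow> nat" where
  "equation_code n = (\<lambda>(E', ts).
     prod_encode
       (set_encode (element_code n ` E'),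
        list_encode
          (map (\<lambda>(h, E). prod_encode (shift_code h, set_encode (element_code n ` E))) ts)))"

text \<open>
  The output consists of the group \<open>H\<^sub>1\<close>, the auxiliary groups \<open>K 0, \<dots>, K (n - 1)\<close>, and the
  system of functional equations, which determines the weakly expressed property.
\<close>

definition output_code ::
    "nat monoid \<Rightarrow> nat \<Rightarrow> (nat \<Rightarrow> nat monoid)
      \<Rightarrow> (int \<times> int \<times> int, unit + nat \<Rightarrow> nat) equation list \<Rightarrow> nat" where
  "output_code H\<^sub>1 n K sys =
     prod_encode
       (group_code H\<^sub>1,
        prod_encode
          (list_encode (map (\<lambda>v. group_code (K v)) [0..<n]),
           list_encode (map (equation_code n) sys)))"

end

theory Submission
  imports Defs "HOL-Number_Theory.Cong"
begin

text \<open>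
  Put \<open>b = c + 1\<close>, where \<open>c\<close> is the code of the initial condition.  A number \<open>u < b\<^sup>N\<close> records in its
  base \<open>b\<close> digits, for every column \<open>n\<close>, a pair of a residue \<open>\<sigma>\<^sub>n(m mod q)\<close> and a digit \<open>F(n, m)\<close>;
  it is admissible if the pairs are in \<open>C\<close> and the digits form a member of \<open>S\<close>.  A solution of the
  puzzle amounts to an admissible \<open>u(i, j)\<close> at every point of \<open>\<int>\<^sup>2\<close>, describing the cells
  \<open>(n, j n + i)\<close>, whose \<open>n\<close>-th entry is invariant under the shift \<open>(n, -1)\<close> and whose \<open>n\<close>-th residues at
  \<open>q\<close> horizontally consecutive points are distinct.

  All of this is expressed by a single function \<open>\<alpha>\<close> with values in \<open>(\<int>/m)\<^sup>k\<close>, \<open>k = b\<^sup>N\<close>, \<open>m\<close> odd and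
  large, that should equal \<open>\<plusminus>e\<^sub>u\<close> with opposite signs at \<open>x\<close> and \<open>x + (0, 0, 1)\<close>; no auxiliary
  functions are needed.  For linear forms \<open>\<phi>\<close> on the group, the equation
  \<open>{\<phi>(\<alpha>(x))} \<uplus> {\<phi>(\<alpha>(x + (0, 0, 1)))} = {1, -1}\<close>, pulled back along \<open>\<phi>\<close>, is imposed for \<open>\<phi> = -\<tau>\<close> and
  \<open>\<phi> = 2 a\<^sub>u - \<tau>\<close>, with \<open>\<tau>\<close> the sum of the admissible coordinates \<open>a\<^sub>u\<close>.  It forces every admissible
  coordinate to be \<open>0\<close> or \<open>\<tau> = \<plusminus>1\<close>, and summation shows that exactly one of them is nonzero.
  Periodicity is the equation \<open>(\<alpha>(x) + ker \<phi>) \<uplus> (\<alpha>(x + h) + (ker \<phi>)\<^sup>c) = (\<int>/m)\<^sup>k\<close>, and distinctness of the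
  residues \<open>r\<close> is the partition of \<open>{\<plusminus>1, \<dots>, \<plusminus>q}\<close> by the values \<open>\<plusminus>(r + 1)\<close>, which makes
  the signs irrelevant.
\<close>

section \<open>Computable functions\<close>

text \<open>\<open>e\<close> lists the variables on which the value may depend; \<open>ext e\<close> adds a bound variable in front.\<close>

definition computable :: "('a \<Rightarrow> nat list) \<Rightarrow> ('a \<Rightarrow> nat) \<Rightarrow> bool" where
  "computable e f \<longleftrightarrow> (\<exists>l. \<forall>a. length (e a) = l) \<and> (\<exists>A. \<forall>a. yields A (e a) (f a))"

definition ext :: "('a \<Rightarrow> nat list) \<Rightarrow> nat \<times> 'a \<Rightarrow> nat list" where
  "ext e p = fst p # e (snd p)"

lemma computable_length: "computable e f \<Longrightarrow> \<exists>l. \<forall>a. length (e a) = l"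
  by (simp add: computable_def)

lemma length_ext: "(\<exists>l. \<forall>a. length (ext e a) = l) \<longleftrightarrow> (\<exists>l. \<forall>a. length (e a) = l)"
  by (auto simp: ext_def) (metis Suc_inject)+

lemma computable_nth: "(\<And>a. length (e a) = l) \<Longrightarrow> i < l \<Longrightarrow> computable e (\<lambda>a. e a ! i)"
  unfolding computable_def by (metis yields.intros(3))

text \<open>Substitution. Every change of variables below goes through this rule: the argument list
  \<open>es\<close> is assembled from computable entries \<open>fs\<close>, in most cases
  projections.\<close>

lemma computable_compose:
  assumes e: "\<exists>l. \<forall>a. length (e a) = l" and g: "\<And>a. yields G (es a) (g a)"
    and es: "\<And>a. es a = map (\<lambda>f. f a) fs" and fs: "\<And>f. f \<in> set fs \<Longrightarrow> computable e f"
  shows "computable e g"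
proof -
  from fs have "\<forall>f\<in>set fs. \<exists>A. \<forall>a. yields A (e a) (f a)" by (simp add: computable_def)
  then obtain A where A: "\<And>f a. f \<in> set fs \<Longrightarrow> yields (A f) (e a) (f a)" by metis
  have "yields (Comp G (map A fs)) (e a) (g a)" for a
    by (rule yields.intros(4)[of _ _ "es a"])
       (use A g in \<open>auto simp: es list_all2_conv_all_nth\<close>)
  with e show ?thesis unfolding computable_def by blast
qed

lemma computable_Suc:
  assumes "computable e f" shows "computable e (\<lambda>a. Suc (f a))"
  by (rule computable_compose[where G = Succ and es = "\<lambda>a. [f a]" and fs = "[f]"])
     (use assms computable_length in \<open>auto intro: yields.intros\<close>)

lemma computable_zero: "\<exists>l. \<forall>a. length (e a) = l \<Longrightarrow> computable e (\<lambda>_. 0)"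
  unfolding computable_def by (blast intro: yields.intros)

lemma computable_const: "\<exists>l. \<forall>a. length (e a) = l \<Longrightarrow> computable e (\<lambda>_. n)"
  by (induction n) (simp_all add: computable_zero computable_Suc)

lemma computable_fst: "\<exists>l. \<forall>a. length (e a) = l \<Longrightarrow> computable (ext e) fst"
  using computable_nth[of "ext e" _ 0] by (auto simp: ext_def)

text \<open>Weakening by a bound variable in front. The algorithm for \<open>f\<close> is fed with
  the projections that skip entry 0; finitely many of them suffice because the length of
  \<open>e a\<close> does not depend on \<open>a\<close>.\<close>

lemma computable_snd:
  assumes "computable e f" shows "computable (ext e) (\<lambda>p. f (snd p))"
proof -
  from assms obtain l A where l: "\<And>a. length (e a) = l" and A: "\<And>a. yields A (e a) (f a)"
    unfolding computable_def by blast
  show ?thesis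
  proof (rule computable_compose[where G = A and es = "\<lambda>p. e (snd p)"
        and fs = "map (\<lambda>i p. ext e p ! Suc i) [0..<l]"])
    show "\<exists>l. \<forall>a. length (ext e a) = l" using l length_ext by blast
    show "e (snd p) = map (\<lambda>f. f p) (map (\<lambda>i p. ext e p ! Suc i) [0..<l])" for p
      by (rule nth_equalityI) (auto simp: l ext_def)
    show "computable (ext e) g" if "g \<in> set (map (\<lambda>i p. ext e p ! Suc i) [0..<l])" for g
    proof -
      from that obtain i where i: "i < l" "g = (\<lambda>p. ext e p ! Suc i)" by auto
      show ?thesis unfolding i(2)
        by (rule computable_nth[where l = "Suc l"]) (simp_all add: ext_def l i(1))
    qed
  qed (rule A)
qed

text \<open>\<open>ext (ext e)\<close> lists the counter, the previous value and the variables in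
  exactly the order in which \<open>PrimRec\<close> passes them to its step. The arithmetic
  operations below are obtained by writing them as \<open>rec_nat\<close>.\<close>

lemma computable_rec_nat:
  assumes b: "computable e b" and k: "computable e k"
    and s: "computable (ext (ext e)) (\<lambda>p. s (fst p) (fst (snd p)) (snd (snd p)))"
  shows "computable e (\<lambda>a. rec_nat (b a) (\<lambda>n r. s n r a) (k a))"
proof -
  from b obtain l B where l: "\<And>a. length (e a) = l" and B: "\<And>a. yields B (e a) (b a)"
    unfolding computable_def by blast
  from s obtain T where "\<And>p. yields T (ext (ext e) p) (s (fst p) (fst (snd p)) (snd (snd p)))"
    unfolding computable_def by blast
  from this[of "(n, r, a)" for n r a] have T: "yields T (n # r # e a) (s n r a)" for n r a
    by (simp add: ext_def)
  have rec: "yields (PrimRec B T) (m # e a) (rec_nat (b a) (\<lambda>n r. s n r a) m)" for m a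
    by (induction m) (auto intro: yields.intros B T)
  show ?thesis
  proof (rule computable_compose[where G = "PrimRec B T" and es = "\<lambda>a. k a # e a"
        and fs = "k # map (\<lambda>i a. e a ! i) [0..<l]"])
    show "k a # e a = map (\<lambda>f. f a) (k # map (\<lambda>i a. e a ! i) [0..<l])" for a
      using l by (auto intro: nth_equalityI)
    show "computable e g" if "g \<in> set (k # map (\<lambda>i a. e a ! i) [0..<l])" for g
      using that l k by (auto intro!: computable_nth[where l = l])
  qed (use l rec in blast)+
qed

lemmas computable_basic = computable_zero computable_const computable_fst length_ext[THEN iffD2]

section \<open>Arithmetic and bounded sums by primitive recursion\<close>

lemma computable_add:
  assumes "computable e f" "computable e g" shows "computable e (\<lambda>a. f a + g a)"
proof -
  note l = computable_length[OF assms(1)]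
  have "rec_nat m (\<lambda>_ r. Suc r) n = m + n" for m n by (induction n) auto
  with computable_rec_nat[OF assms, of "\<lambda>_ r _. Suc r"] show ?thesis
    using computable_snd[OF computable_fst[OF l]] by (simp add: computable_Suc)
qed

lemma computable_pred:
  assumes "computable e f" shows "computable e (\<lambda>a. f a - 1)"
proof -
  note l = computable_length[OF assms(1)]
  \<comment> \<open>The step returns the counter, which is the predecessor of the number
    reached.\<close>
  have "rec_nat 0 (\<lambda>n _. n) n = n - 1" for n by (cases n) auto
  with computable_rec_nat[OF computable_zero[OF l] assms, of "\<lambda>n _ _. n"] show ?thesis
    using computable_fst[OF length_ext[THEN iffD2, OF l]] by simp
qed

lemma computable_diff:
  assumes "computable e f" "computable e g" shows "computable e (\<lambda>a. f a - g a)"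
proof -
  note l = computable_length[OF assms(1)]
  have "rec_nat m (\<lambda>_ r. r - 1) n = m - n" for m n by (induction n) auto
  with computable_rec_nat[OF assms, of "\<lambda>_ r _. r - 1"] show ?thesis
    using computable_snd[OF computable_fst[OF l]] computable_pred by auto
qed

lemma computable_mult:
  assumes "computable e f" "computable e g" shows "computable e (\<lambda>a. f a * g a)"
proof -
  note l = computable_length[OF assms(1)]
  have "rec_nat 0 (\<lambda>_ r. r + m) n = m * n" for m n by (induction n) auto
  with computable_rec_nat[OF computable_zero[OF l] assms(2), of "\<lambda>_ r a. r + f a"] show ?thesis
    using computable_snd[OF computable_fst[OF l]] computable_snd[OF computable_snd[OF assms(1)]]
    by (simp add: computable_add)
qed

lemma computable_power:
  assumes "computable e f" "computable e g" shows "computable e (\<lambda>a. f a ^ g a)"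
proof -
  note l = computable_length[OF assms(1)]
  have "rec_nat 1 (\<lambda>_ r. r * m) n = m ^ n" for m n :: nat by (induction n) auto
  with computable_rec_nat[OF computable_const[OF l, of 1] assms(2), of "\<lambda>_ r a. r * f a"] show ?thesis
    using computable_snd[OF computable_fst[OF l]] computable_snd[OF computable_snd[OF assms(1)]]
    by (simp add: computable_mult)
qed

text \<open>Weakening in the second place. In a recursion the accumulator stands between the counter
  and the variables, while a summand depends only on the latter two; index 1 is therefore left out
  of the projections.\<close>

lemma computable_swap:
  assumes "computable (ext e) (\<lambda>p. f (fst p) (snd p))"
  shows "computable (ext (ext e)) (\<lambda>p. f (fst p) (snd (snd p)))"
proof -
  from assms obtain l A where "\<And>p. length (ext e p) = Suc l"
    and A: "\<And>p. yields A (ext e p) (f (fst p) (snd p))"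
    unfolding computable_def ext_def by (metis length_Cons)
  from this(1)[of "(0, a)" for a] have l: "length (e a) = l" for a by (simp add: ext_def)
  show ?thesis
  proof (rule computable_compose[where G = A and es = "\<lambda>p. fst p # e (snd (snd p))"
        and fs = "map (\<lambda>i p. ext (ext e) p ! i) (0 # [2..<Suc (Suc l)])"])
    show "\<exists>l. \<forall>a. length (ext (ext e) a) = l" using l by (auto simp: ext_def)
    show "yields A (fst p # e (snd (snd p))) (f (fst p) (snd (snd p)))" for p :: "nat \<times> nat \<times> 'a"
      using A[of "(fst p, snd (snd p))"] by (simp add: ext_def)
    show "fst p # e (snd (snd p))
        = map (\<lambda>f. f p) (map (\<lambda>i p. ext (ext e) p ! i) (0 # [2..<Suc (Suc l)]))"
      for p :: "nat \<times> nat \<times> 'a"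
      using l by (auto intro!: nth_equalityI simp: ext_def nth_Cons' simp del: upt_Suc)
    show "computable (ext (ext e)) g"
      if "g \<in> set (map (\<lambda>i p. ext (ext e) p ! i) (0 # [2..<Suc (Suc l)]))" for g
    proof -
      from that obtain i where i: "i < Suc (Suc l)" "g = (\<lambda>p. ext (ext e) p ! i)"
        by (auto simp del: upt_Suc)
      show ?thesis unfolding i(2)
        by (rule computable_nth[where l = "Suc (Suc l)"]) (simp_all add: ext_def l i(1))
    qed
  qed
qed

lemma computable_sum:
  assumes f: "computable (ext e) (\<lambda>p. f (fst p) (snd p))" and k: "computable e k"
  shows "computable e (\<lambda>a. \<Sum>i<k a. f i a)"
proof -
  note l = computable_length[OF k]
  have "rec_nat 0 (\<lambda>i r. r + f i a) n = (\<Sum>i<n. f i a)" for a n by (induction n) auto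
  with computable_rec_nat[OF computable_zero[OF l] k, of "\<lambda>i r a. r + f i a"] show ?thesis
    using computable_snd[OF computable_fst[OF l]] computable_swap[OF f] by (simp add: computable_add)
qed

section \<open>Decidable predicates, bounded search, and the standard codings\<close>

definition decidable :: "('a \<Rightarrow> nat list) \<Rightarrow> ('a \<Rightarrow> bool) \<Rightarrow> bool" where
  "decidable e P \<longleftrightarrow> computable e (\<lambda>a. of_bool (P a))"

lemma decidable_not: "decidable e P \<Longrightarrow> decidable e (\<lambda>a. \<not> P a)"
proof -
  assume *: "decidable e P"
  have "of_bool (\<not> p) = 1 - (of_bool p :: nat)" for p by simp
  then show ?thesis
    using * computable_length[of e] unfolding decidable_def by (simp only: computable_diff computable_const)
qed

lemma decidable_conj: "decidable e P \<Longrightarrow> decidable e Q \<Longrightarrow> decidable e (\<lambda>a. P a \<and> Q a)"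
  unfolding decidable_def of_bool_conj by (rule computable_mult)

lemma decidable_disj:
  assumes "decidable e P" "decidable e Q" shows "decidable e (\<lambda>a. P a \<or> Q a)"
  using decidable_not[OF decidable_conj[OF decidable_not[OF assms(1)] decidable_not[OF assms(2)]]]
  by simp

lemma decidable_le:
  assumes "computable e f" "computable e g" shows "decidable e (\<lambda>a. f a \<le> g a)"
proof -
  have "of_bool (m \<le> n) = 1 - (m - n)" for m n :: nat by simp
  then show ?thesis unfolding decidable_def
    using assms computable_length[OF assms(1)] by (simp add: computable_diff computable_const)
qed

lemma decidable_less:
  assumes "computable e f" "computable e g" shows "decidable e (\<lambda>a. f a < g a)"
  using decidable_le[OF computable_Suc[OF assms(1)] assms(2)] by (simp add: Suc_le_eq)

lemma decidable_eq:
  assumes "computable e f" "computable e g" shows "decidable e (\<lambda>a. f a = g a)"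
  using decidable_conj[OF decidable_le[OF assms] decidable_le[OF assms(2,1)]]
  by (simp add: eq_iff)

lemma computable_if:
  assumes "decidable e P" "computable e f" "computable e g"
  shows "computable e (\<lambda>a. if P a then f a else g a)"
proof -
  have "(if p then m else n) = of_bool p * m + of_bool (\<not> p) * n" for p and m n :: nat by simp
  then show ?thesis
    using assms decidable_not[OF assms(1)] unfolding decidable_def
    by (simp only: computable_add computable_mult)
qed

text \<open>A bounded quantifier becomes a bounded sum: the characteristic values add up to the
  bound exactly when all of them are 1.\<close>

lemma decidable_all:
  assumes P: "decidable (ext e) (\<lambda>p. P (fst p) (snd p))" and k: "computable e k"
  shows "decidable e (\<lambda>a. \<forall>i<k a. P i a)"
proof -
  have *: "decidable e (\<lambda>a. (\<Sum>i<k a. of_bool (P i a)) = k a)"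
    by (intro decidable_eq computable_sum k P[unfolded decidable_def])
  have "(\<Sum>i<n. of_bool (Q i)) = n \<longleftrightarrow> (\<forall>i<n. Q i)" for Q and n :: nat
  proof -
    have "(\<Sum>i<n. of_bool (Q i)) = card {i\<in>{..<n}. Q i}" by (simp add: Int_def)
    also have "\<dots> = n \<longleftrightarrow> {i\<in>{..<n}. Q i} = {..<n}"
      by (metis (no_types, lifting) card_lessThan card_subset_eq finite_lessThan mem_Collect_eq subsetI)
    finally show ?thesis by auto
  qed
  with * show ?thesis by simp
qed

lemma computable_div:
  assumes "computable e f" "computable e g" shows "computable e (\<lambda>a. f a div g a)"
proof -
  \<comment> \<open>The quotient counts the positive multiples of \<open>n\<close> up to
    \<open>m\<close>; the guard gives the value 0 for \<open>n = 0\<close>.\<close>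
  have "m div n = (\<Sum>i<m. of_bool (0 < n \<and> Suc i * n \<le> m))" for m n :: nat
  proof (cases "n = 0")
    case False
    then have "(\<Sum>i<m. of_bool (0 < n \<and> Suc i * n \<le> m)) = card {i\<in>{..<m}. Suc i * n \<le> m}"
      by (simp add: Int_def)
    also have "{i\<in>{..<m}. Suc i * n \<le> m} = {..<m div n}"
      using False by (auto simp: less_eq_div_iff_mult_less_eq[symmetric] Suc_le_eq
          simp del: mult_Suc intro: less_le_trans[OF _ div_le_dividend])
    finally show ?thesis by simp
  qed simp
  moreover have "computable e (\<lambda>a. \<Sum>i<f a. of_bool (0 < g a \<and> Suc i * g a \<le> f a))"
    using computable_length[OF assms(1)]
    by (intro computable_sum assms decidable_conj[unfolded decidable_def]
        decidable_less[unfolded decidable_def] decidable_le[unfolded decidable_def]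
        computable_mult computable_Suc computable_snd[OF assms(1)] computable_snd[OF assms(2)]
        computable_basic)
  ultimately show ?thesis by simp
qed

lemma computable_mod:
  assumes "computable e f" "computable e g" shows "computable e (\<lambda>a. f a mod g a)"
  using computable_diff[OF assms(1) computable_mult[OF assms(2) computable_div[OF assms]]]
  by (simp add: minus_mult_div_eq_mod)

lemma computable_prod_encode:
  assumes "computable e f" "computable e g" shows "computable e (\<lambda>a. prod_encode (f a, g a))"
  unfolding prod_encode_def triangle_def split
  using computable_length[OF assms(1)]
  by (intro computable_add computable_div computable_mult computable_Suc assms computable_basic)

text \<open>Decoding by search: both components are at most the code, so in the double sum over all
  pairs below \<open>Suc z\<close> exactly one summand survives.\<close>

lemma computable_prod_decode:
  assumes "computable e f"
  shows "computable e (\<lambda>a. fst (prod_decode (f a)))" "computable e (\<lambda>a. snd (prod_decode (f a)))"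
proof -
  have sum: "h (prod_decode z) = (\<Sum>m<Suc z. \<Sum>n<Suc z. if prod_encode (m, n) = z then h (m, n) else 0)"
    for z and h :: "nat \<times> nat \<Rightarrow> nat"
  proof -
    obtain k l where kl: "prod_decode z = (k, l)" by fastforce
    then have z: "z = prod_encode (k, l)" by (metis prod_decode_inverse)
    have eq: "prod_encode (m, n) = z \<longleftrightarrow> m = k \<and> n = l" for m n by (simp add: z)
    have "k < Suc z" "l < Suc z" by (simp_all add: z le_prod_encode_1 le_prod_encode_2 less_Suc_eq_le)
    then have "(\<Sum>n<Suc z. if prod_encode (m, n) = z then h (m, n) else 0)
        = (if m = k then h (k, l) else 0)" for m
      by (cases "m = k") (simp_all add: eq sum.delta del: sum.lessThan_Suc)
    with \<open>k < Suc z\<close> show ?thesis by (simp add: kl sum.delta del: sum.lessThan_Suc)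
  qed
  have l: "\<exists>l. \<forall>a. length (e a) = l" by (rule computable_length[OF assms])
  have "computable e (\<lambda>a. \<Sum>m<Suc (f a). \<Sum>n<Suc (f a). if prod_encode (m, n) = f a then m else 0)"
    using l
    by (intro computable_sum computable_if decidable_eq computable_prod_encode computable_Suc
        computable_snd[OF computable_snd[OF assms]] computable_snd[OF assms] assms computable_basic
        computable_snd[OF computable_fst])
  then show "computable e (\<lambda>a. fst (prod_decode (f a)))"
    unfolding sum[of fst] fst_conv snd_conv .
  have "computable e (\<lambda>a. \<Sum>m<Suc (f a). \<Sum>n<Suc (f a). if prod_encode (m, n) = f a then n else 0)"
    using l
    by (intro computable_sum computable_if decidable_eq computable_prod_encode computable_Suc
        computable_snd[OF computable_snd[OF assms]] computable_snd[OF assms] assms computable_basic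
        computable_snd[OF computable_fst])
  then show "computable e (\<lambda>a. snd (prod_decode (f a)))"
    unfolding sum[of snd] fst_conv snd_conv .
qed

lemma decidable_set_decode:
  assumes "computable e f" "computable e g" shows "decidable e (\<lambda>a. f a \<in> set_decode (g a))"
proof -
  have "decidable e (\<lambda>a. (g a div 2 ^ f a) mod 2 = 1)"
    using computable_length[OF assms(1)]
    by (intro decidable_eq computable_mod computable_div computable_power assms computable_basic)
  then show ?thesis by (simp add: set_decode_def odd_iff_mod_2_eq_one)
qed

text \<open>A list code is built from the end of the list, by putting entries in front of the tail.
  Keeping an arbitrary tail \<open>xs\<close> makes the rule applicable to concatenations of several
  lists.\<close>

lemma computable_list_encode:
  assumes f: "computable (ext e) (\<lambda>p. f (fst p) (snd p))" and k: "computable e k"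
    and xs: "computable e (\<lambda>a. list_encode (xs a))"
  shows "computable e (\<lambda>a. list_encode (map (\<lambda>i. f i a) [0..<k a] @ xs a))"
proof -
  note l = computable_length[OF k]
  let ?s = "\<lambda>i r a. Suc (prod_encode (f (k a - Suc i) a, r))"
  \<comment> \<open>Invariant: after \<open>n\<close> rounds the last \<open>n\<close> entries stand
    in front of \<open>xs\<close>.\<close>
  have *: "rec_nat (list_encode (xs a)) (\<lambda>i r. ?s i r a) n
      = list_encode (map (\<lambda>i. f i a) [k a - n..<k a] @ xs a)" if "n \<le> k a" for a n
    using that
  proof (induction n)
    case (Suc n)
    then have "[k a - Suc n..<k a] = (k a - Suc n) # [k a - n..<k a]"
      by (subst upt_conv_Cons) (auto simp: Suc_diff_Suc)
    with Suc show ?case by simp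
  qed simp
  \<comment> \<open>Round \<open>i\<close> needs the entry with index \<open>k a - Suc i\<close>, so
    this index is substituted for the first argument of the algorithm for \<open>f\<close>.\<close>
  have "computable (ext e) (\<lambda>p. f (k (snd p) - Suc (fst p)) (snd p))"
  proof -
    from f obtain l A where A: "\<And>p. yields A (ext e p) (f (fst p) (snd p))"
      and "\<And>p. length (ext e p) = Suc l"
      unfolding computable_def ext_def by (metis length_Cons)
    from this(2)[of "(0, a)" for a] have l: "length (e a) = l" for a by (simp add: ext_def)
    then have l': "\<exists>l. \<forall>a. length (e a) = l" by blast
    show ?thesis
    proof (rule computable_compose[where G = A and es = "\<lambda>p. (k (snd p) - Suc (fst p)) # e (snd p)"
          and fs = "(\<lambda>p. k (snd p) - Suc (fst p)) # map (\<lambda>i p. e (snd p) ! i) [0..<l]"])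
      show "\<exists>l. \<forall>a. length (ext e a) = l" using l by (auto simp: ext_def)
      show "yields A ((k (snd p) - Suc (fst p)) # e (snd p)) (f (k (snd p) - Suc (fst p)) (snd p))"
        for p using A[of "(k (snd p) - Suc (fst p), snd p)"] by (simp add: ext_def)
      show "(k (snd p) - Suc (fst p)) # e (snd p) = map (\<lambda>f. f p)
          ((\<lambda>p. k (snd p) - Suc (fst p)) # map (\<lambda>i p. e (snd p) ! i) [0..<l])" for p
        using l by (auto intro: nth_equalityI)
      have "computable (ext e) (\<lambda>p. k (snd p) - Suc (fst p))"
        by (intro computable_diff computable_Suc computable_snd[OF k] computable_basic l')
      then show "computable (ext e) g"
        if "g \<in> set ((\<lambda>p. k (snd p) - Suc (fst p)) # map (\<lambda>i p. e (snd p) ! i) [0..<l])" for g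
        using that l by (auto intro!: computable_snd[of e "\<lambda>a. e a ! i" for i] computable_nth)
    qed
  qed
  from computable_swap[of e "\<lambda>i a. f (k a - Suc i) a", OF this]
  have "computable e (\<lambda>a. rec_nat (list_encode (xs a)) (\<lambda>i r. ?s i r a) (k a))"
    by (intro computable_rec_nat xs k computable_Suc computable_prod_encode
        computable_snd[OF computable_fst[OF l]])
  then show ?thesis by (simp add: *)
qed

section \<open>Vectors as numbers\<close>

definition digit :: "nat \<Rightarrow> nat \<Rightarrow> nat \<Rightarrow> nat" where
  "digit m i v = v div m ^ i mod m"

definition vector :: "nat \<Rightarrow> nat \<Rightarrow> (nat \<Rightarrow> nat) \<Rightarrow> nat" where
  "vector m k d = (\<Sum>i<k. d i * m ^ i)"

text \<open>The group (Z/m)^k. Base \<open>m\<close> numerals serve as elements because the output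
  must consist of groups on natural numbers, and because group operations then become
  arithmetic.\<close>

definition vector_group :: "nat \<Rightarrow> nat \<Rightarrow> nat monoid" where
  "vector_group m k = \<lparr>carrier = {..<m ^ k},
     monoid.mult = (\<lambda>v w. vector m k (\<lambda>i. (digit m i v + digit m i w) mod m)), one = 0\<rparr>"

lemma digit_less: "0 < m \<Longrightarrow> digit m i v < m"
  by (simp add: digit_def)

lemma vector_less: "(\<And>i. i < k \<Longrightarrow> d i < m) \<Longrightarrow> vector m k d < m ^ k"
proof (induction k)
  case (Suc k)
  then have "vector m k d < m ^ k" "Suc (d k) \<le> m" by (simp_all add: Suc_leI)
  then have "vector m k d + d k * m ^ k < Suc (d k) * m ^ k" by simp
  also have "\<dots> \<le> m * m ^ k" using \<open>Suc (d k) \<le> m\<close> by (intro mult_right_mono) simp_all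
  finally show ?case by (simp add: vector_def)
qed (simp add: vector_def)

lemma digit_vector:
  assumes "\<And>i. i < k \<Longrightarrow> d i < m" "j < k" shows "digit m j (vector m k d) = d j"
  using assms
proof (induction k)
  case (Suc k)
  have less: "vector m k d < m ^ k" using Suc.prems by (intro vector_less) simp
  have m: "0 < m" using Suc.prems by fastforce
  have eq: "vector m (Suc k) d = vector m k d + d k * m ^ k" by (simp add: vector_def)
  show ?case
  proof (cases "j = k")
    case True
    with less m Suc.prems show ?thesis by (simp add: digit_def eq)
  next
    case False
    with Suc.prems have j: "j < k" by simp
    \<comment> \<open>\<open>m ^ k\<close> contains the factor \<open>m ^ Suc j\<close>, so the
      leading term does not influence digit \<open>j\<close>.\<close>
    then have "m ^ k = m ^ j * (m * m ^ (k - Suc j))"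
      by (metis Suc_diff_Suc add_diff_inverse_nat less_imp_not_less power_Suc power_add)
    with m have "(vector m k d + d k * m ^ k) div m ^ j mod m = vector m k d div m ^ j mod m"
      by (simp add: mult.left_commute[of "d k"] mult.left_commute[of "d k" m])
    with Suc j show ?thesis by (simp add: digit_def eq)
  qed
qed simp

lemma vector_digit: "v < m ^ k \<Longrightarrow> vector m k (\<lambda>i. digit m i v) = v"
proof (induction k arbitrary: v)
  case (Suc k)
  have m: "0 < m" using Suc.prems by (cases m) auto
  have dig: "digit m i (v mod m ^ k) = digit m i v" if "i < k" for i
  proof -
    have "m ^ k = m ^ i * (m * m ^ (k - Suc i))"
      using that by (metis Suc_diff_Suc add_diff_inverse_nat less_imp_not_less power_Suc power_add)
    then show ?thesis
      by (simp add: digit_def mod_mult2_eq m)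
  qed
  have "vector m k (\<lambda>i. digit m i v) = v mod m ^ k"
    using Suc.IH[of "v mod m ^ k"] m by (simp add: vector_def dig)
  moreover have "digit m k v = v div m ^ k"
    using Suc.prems by (simp add: digit_def less_mult_imp_div_less)
  ultimately show ?case by (simp add: vector_def mod_div_mult_eq)
qed (simp add: vector_def)

lemma digit_ext:
  assumes "v < m ^ k" "w < m ^ k" "\<And>i. i < k \<Longrightarrow> digit m i v = digit m i w" shows "v = w"
proof -
  have "vector m k (\<lambda>i. digit m i v) = vector m k (\<lambda>i. digit m i w)"
    using assms(3) by (simp add: vector_def)
  then show ?thesis using assms(1,2) by (simp add: vector_digit)
qed

lemma carrier_vector_group [simp]: "carrier (vector_group m k) = {..<m ^ k}"
  and one_vector_group [simp]: "\<one>\<^bsub>vector_group m k\<^esub> = 0"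
  by (simp_all add: vector_group_def)

lemma mult_vector_group:
  "v \<otimes>\<^bsub>vector_group m k\<^esub> w = vector m k (\<lambda>i. (digit m i v + digit m i w) mod m)"
  by (simp add: vector_group_def)

lemma digit_mult:
  "0 < m \<Longrightarrow> i < k \<Longrightarrow>
    digit m i (v \<otimes>\<^bsub>vector_group m k\<^esub> w) = (digit m i v + digit m i w) mod m"
  unfolding mult_vector_group by (rule digit_vector) simp_all

lemma vector_group:
  assumes m: "0 < m" shows "finite_abelian (vector_group m k)"
proof
  have less: "v \<otimes>\<^bsub>vector_group m k\<^esub> w < m ^ k" for v w
    using m by (simp add: mult_vector_group vector_less)
  show "comm_group (vector_group m k)"
  proof (rule comm_groupI)
    fix x y z
    assume xyz: "x \<in> carrier (vector_group m k)" "y \<in> carrier (vector_group m k)"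
      "z \<in> carrier (vector_group m k)"
    show "x \<otimes>\<^bsub>vector_group m k\<^esub> y \<otimes>\<^bsub>vector_group m k\<^esub> z
        = x \<otimes>\<^bsub>vector_group m k\<^esub> (y \<otimes>\<^bsub>vector_group m k\<^esub> z)"
      by (rule digit_ext[OF less less]) (simp add: digit_mult m mod_simps add.assoc)
  next
    fix x y
    assume xy: "x \<in> carrier (vector_group m k)" "y \<in> carrier (vector_group m k)"
    show "x \<otimes>\<^bsub>vector_group m k\<^esub> y \<in> carrier (vector_group m k)" using less by simp
    show "x \<otimes>\<^bsub>vector_group m k\<^esub> y = y \<otimes>\<^bsub>vector_group m k\<^esub> x"
      by (simp add: mult_vector_group add.commute)
  next
    fix x
    assume x: "x \<in> carrier (vector_group m k)"
    show "\<one>\<^bsub>vector_group m k\<^esub> \<otimes>\<^bsub>vector_group m k\<^esub> x = x"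
      using m x by (intro digit_ext[OF less]) (auto simp: digit_mult, simp add: digit_def)
    \<comment> \<open>Digitwise negation; the outer \<open>mod m\<close> takes care of the digit
      0.\<close>
    let ?y = "vector m k (\<lambda>i. (m - digit m i x) mod m)"
    have "?y \<otimes>\<^bsub>vector_group m k\<^esub> x = 0"
    proof (rule digit_ext[OF less])
      fix i assume "i < k"
      then have "digit m i ?y = (m - digit m i x) mod m" using m by (intro digit_vector) simp_all
      then have "digit m i (?y \<otimes>\<^bsub>vector_group m k\<^esub> x) = (m - digit m i x + digit m i x) mod m"
        using m \<open>i < k\<close> by (simp add: digit_mult mod_simps)
      then show "digit m i (?y \<otimes>\<^bsub>vector_group m k\<^esub> x) = digit m i 0"
        using digit_less[OF m, of i x] by (simp add: digit_def)
    qed (use m in simp)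
    moreover have "?y < m ^ k" using m by (intro vector_less) simp
    ultimately show "\<exists>y\<in>carrier (vector_group m k).
        y \<otimes>\<^bsub>vector_group m k\<^esub> x = \<one>\<^bsub>vector_group m k\<^esub>" by auto
  qed (use m in simp)
qed simp

section \<open>Linear forms on (Z/m)^k and the translates of their kernels\<close>

definition form :: "nat \<Rightarrow> nat \<Rightarrow> (nat \<Rightarrow> nat) \<Rightarrow> nat \<Rightarrow> nat" where
  "form m k w v = (\<Sum>i<k. w i * digit m i v) mod m"

lemma form_less: "0 < m \<Longrightarrow> form m k w v < m"
  by (simp add: form_def)

lemma form_mult:
  assumes "0 < m"
  shows "form m k w (u \<otimes>\<^bsub>vector_group m k\<^esub> v) = (form m k w u + form m k w v) mod m"
proof -
  have "form m k w (u \<otimes>\<^bsub>vector_group m k\<^esub> v)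
      = (\<Sum>i<k. w i * ((digit m i u + digit m i v) mod m)) mod m"
    by (simp add: form_def digit_mult assms)
  also have "\<dots> = (\<Sum>i<k. w i * (digit m i u + digit m i v)) mod m"
    by (subst (1 2) mod_sum_eq[symmetric]) (simp add: mod_simps)
  finally show ?thesis
    by (simp add: form_def mod_simps distrib_left sum.distrib)
qed

text \<open>The form is a homomorphism, so translation by \<open>v\<close> shifts its values by the
  value at \<open>v\<close>; conversely each \<open>y\<close> of the right-hand set is
  \<open>v\<close> times the element obtained by dividing by \<open>v\<close>.\<close>

lemma coset_form:
  assumes m: "0 < m" and v: "v < m ^ k"
    and R: "\<And>r. r < m \<Longrightarrow> R ((form m k w v + r) mod m) \<longleftrightarrow> Q r"
  shows "v <#\<^bsub>vector_group m k\<^esub> {x. x < m ^ k \<and> Q (form m k w x)} = {y. y < m ^ k \<and> R (form m k w y)}"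
proof -
  let ?H = "vector_group m k"
  interpret comm_group ?H using vector_group[OF m] by simp
  show ?thesis
  proof (intro Set.set_eqI iffI)
    fix y assume "y \<in> v <#\<^bsub>?H\<^esub> {x. x < m ^ k \<and> Q (form m k w x)}"
    then obtain x where x: "x < m ^ k" "Q (form m k w x)" "y = v \<otimes>\<^bsub>?H\<^esub> x"
      by (auto simp: l_coset_def)
    then show "y \<in> {y. y < m ^ k \<and> R (form m k w y)}"
      using m_closed[of v x] v by (simp add: form_mult m R form_less)
  next
    fix y assume y: "y \<in> {y. y < m ^ k \<and> R (form m k w y)}"
    define x where "x = inv\<^bsub>?H\<^esub> v \<otimes>\<^bsub>?H\<^esub> y"
    have "v \<in> carrier ?H" "y \<in> carrier ?H" using v y by simp_all
    then have x: "x \<in> carrier ?H" "y = v \<otimes>\<^bsub>?H\<^esub> x"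
      unfolding x_def by (simp_all add: m_assoc[symmetric] del: carrier_vector_group one_vector_group)
    with y have "Q (form m k w x)" by (simp add: form_mult m R form_less)
    with x show "y \<in> v <#\<^bsub>?H\<^esub> {x. x < m ^ k \<and> Q (form m k w x)}"
      by (auto simp: l_coset_def)
  qed
qed

text \<open>The two building blocks of the equations: fibres are the tiles of a partition, and the
  complement of a fibre serves to compare two form values.\<close>

lemma coset_form_zero:
  assumes "0 < m" "v < m ^ k"
  shows "v <#\<^bsub>vector_group m k\<^esub> {x. x < m ^ k \<and> form m k w x = 0}
      = {y. y < m ^ k \<and> form m k w y = form m k w v}"
    and "v <#\<^bsub>vector_group m k\<^esub> {x. x < m ^ k \<and> form m k w x \<noteq> 0}
      = {y. y < m ^ k \<and> form m k w y \<noteq> form m k w v}"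
proof -
  have "(a + r) mod m = a \<longleftrightarrow> r = 0" if "r < m" "a < m" for a r
    using that by (cases "a + r < m") (auto simp: mod_if)
  then show "v <#\<^bsub>vector_group m k\<^esub> {x. x < m ^ k \<and> form m k w x = 0}
      = {y. y < m ^ k \<and> form m k w y = form m k w v}"
    and "v <#\<^bsub>vector_group m k\<^esub> {x. x < m ^ k \<and> form m k w x \<noteq> 0}
      = {y. y < m ^ k \<and> form m k w y \<noteq> form m k w v}"
    using assms
    by (intro coset_form[where Q = "\<lambda>r. r = 0" and R = "\<lambda>r. r = form m k w v"]
        coset_form[where Q = "\<lambda>r. r \<noteq> 0" and R = "\<lambda>r. r \<noteq> form m k w v"];
        simp add: form_less)+
qed

text \<open>The coefficients of \<open>2 a\<^sub>u - \<tau>\<close> modulo \<open>m\<close>, and of \<open>-\<tau>\<close> when \<open>u\<close> is no admissible index.\<close>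

definition selector :: "nat \<Rightarrow> (nat \<Rightarrow> bool) \<Rightarrow> nat \<Rightarrow> nat \<Rightarrow> nat" where
  "selector m G u i = of_bool (G i) * (if i = u then 1 else m - 1)"

lemma int_form: "[int (form m k w v) = (\<Sum>i<k. int (w i) * int (digit m i v))] (mod int m)"
  by (simp add: form_def of_nat_mod cong_def)

lemma form_vector_unit:
  assumes "1 < m" "u < k" "s < m"
  shows "vector m k (\<lambda>i. if i = u then s else 0) < m ^ k"
    and "form m k w (vector m k (\<lambda>i. if i = u then s else 0)) = (w u * s) mod m"
proof -
  let ?v = "vector m k (\<lambda>i. if i = u then s else 0)"
  show "?v < m ^ k" using assms by (intro vector_less) auto
  have "digit m i ?v = (if i = u then s else 0)" if "i < k" for i
    using assms that by (subst digit_vector) auto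
  then have "(\<Sum>i<k. w i * digit m i ?v) = (\<Sum>i<k. if i = u then w u * s else 0)"
    by (intro sum.cong) auto
  then show "form m k w ?v = (w u * s) mod m" using assms(2) by (simp add: form_def)
qed

lemma form_selector:
  assumes m: "0 < m"
  shows "[int (form m k (selector m G u) v) =
      (if u < k \<and> G u then 2 * int (digit m u v) else 0) - (\<Sum>i | i < k \<and> G i. int (digit m i v))]
    (mod int m)"
proof -
  let ?d = "\<lambda>i. int (digit m i v)"
  \<comment> \<open>The coefficient 1 at \<open>u\<close> is read as 2 - 1, and \<open>m - 1\<close>
    as -1.\<close>
  have "[int (selector m G u i) * ?d i = (if G i then (if i = u then 2 * ?d u else 0) - ?d i else 0)]
      (mod int m)" for i
  proof -
    have "[int (m - 1) * ?d i = - ?d i] (mod int m)"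
      using m by (simp add: of_nat_diff cong_iff_dvd_diff algebra_simps)
    then show ?thesis by (auto simp: selector_def)
  qed
  then have "[(\<Sum>i<k. int (selector m G u i) * ?d i)
      = (\<Sum>i<k. if G i then (if i = u then 2 * ?d u else 0) - ?d i else 0)] (mod int m)"
    by (intro cong_sum) auto
  also have "(\<Sum>i<k. if G i then (if i = u then 2 * ?d u else 0) - ?d i else 0)
      = (\<Sum>i | i < k \<and> G i. (if i = u then 2 * ?d u else 0) - ?d i)"
    by (subst sum.inter_filter[symmetric]) (auto intro: sum.cong)
  also have "\<dots> = (if u < k \<and> G u then 2 * ?d u else 0) - (\<Sum>i | i < k \<and> G i. ?d i)"
    by (simp add: sum_subtractf sum.delta)
  finally show ?thesis using int_form cong_trans by blast
qed

text \<open>The digits of \<open>v\<close> outside \<open>G\<close> remain arbitrary, so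
  \<open>v\<close> itself need not be a multiple of a unit vector. It behaves like one under all
  forms whose coefficients vanish outside \<open>G\<close>, and only such forms are used.\<close>

lemma unit_vector:
  assumes m: "odd m" "k < m" "1 < m"
    and sel: "\<And>u. u \<le> k \<Longrightarrow> form m k (selector m G u) v \<in> {1, m - 1}"
  obtains u s where "u < k" "G u" "s \<in> {1, m - 1}"
    "\<And>w. (\<And>i. \<not> G i \<Longrightarrow> w i = 0) \<Longrightarrow> form m k w v = (w u * s) mod m"
proof -
  let ?d = "\<lambda>i. int (digit m i v)" and ?T = "{i. i < k \<and> G i}"
  define S where "S = (\<Sum>i\<in>?T. ?d i)"
  have sgn: "\<exists>c. (c = 1 \<or> c = -1) \<and> [int a = c] (mod int m)" if "a \<in> {1, m - 1}" for a
    using that m(3) by (auto simp: of_nat_diff cong_iff_dvd_diff intro: exI[of _ 1] exI[of _ "-1"])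
  have m_pos: "0 < m" using m by simp
  \<comment> \<open>The index \<open>k\<close> is out of range, so its selector is the negative of
    the sum \<open>S\<close> of the digits in \<open>G\<close>.\<close>
  obtain c where c: "c = 1 \<or> c = -1" "[S = c] (mod int m)"
  proof -
    obtain c where "c = 1 \<or> c = -1" "[int (form m k (selector m G k) v) = c] (mod int m)"
      using sgn[OF sel[of k]] by blast
    moreover have "[int (form m k (selector m G k) v) = - S] (mod int m)"
      using form_selector[OF m_pos, of k G k v] by (simp add: S_def)
    ultimately have "[S = - c] (mod int m)"
      by (metis cong_minus_minus_iff cong_sym cong_trans minus_minus)
    then show ?thesis using that[of "- c"] \<open>c = 1 \<or> c = -1\<close> by auto
  qed
  define s where "s = nat (c mod int m)"
  have s: "s \<in> {1, m - 1}" "[int s = c] (mod int m)" "s < m"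
    using c(1) m(3) by (auto simp: s_def zmod_minus1 nat_diff_distrib cong_def)
  have cop: "coprime 2 (int m)" using m(1) by simp
  have dig: "digit m i v = 0 \<or> digit m i v = s" if "i \<in> ?T" for i
  proof -
    have "form m k (selector m G i) v \<in> {1, m - 1}" using sel[of i] that by simp
    then obtain a where a: "a = 1 \<or> a = -1" "[int (form m k (selector m G i) v) = a] (mod int m)"
      using sgn by blast
    moreover have "[int (form m k (selector m G i) v) = 2 * ?d i - S] (mod int m)"
      using form_selector[OF m_pos, of k G i v] that by (simp add: S_def)
    ultimately have "[2 * ?d i - S = a] (mod int m)" by (metis cong_sym cong_trans)
    from cong_add[OF this c(2)] have "[2 * ?d i = a + c] (mod int m)" by simp
    \<comment> \<open>Two signs either cancel or agree. As \<open>m\<close> is odd, the factor 2 can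
      then be divided out, which leaves 0 or \<open>c\<close> for the digit.\<close>
    moreover have "a + c = 2 * 0 \<or> a + c = 2 * c" using a(1) c(1) by auto
    ultimately have "[2 * ?d i = 2 * 0] (mod int m) \<or> [2 * ?d i = 2 * c] (mod int m)" by metis
    then have "[?d i = 0] (mod int m) \<or> [?d i = c] (mod int m)"
      unfolding cong_mult_lcancel[OF cop] .
    then have "[?d i = int 0] (mod int m) \<or> [?d i = int s] (mod int m)"
      using s(2) by (metis cong_sym cong_trans of_nat_0)
    then show ?thesis
      unfolding cong_int_iff using digit_less[OF m_pos, of i v] s(3) m_pos
      by (auto simp: cong_def)
  qed
  define T where "T = {i\<in>?T. digit m i v = s}"
  have T: "T \<subseteq> ?T" "finite T" by (auto simp: T_def)
  have "s \<noteq> 0" using s(1) m(3) by auto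
  have "S = (\<Sum>i\<in>T. int s)"
    unfolding S_def T_def using dig by (intro sum.mono_neutral_cong_right) fastforce+
  \<comment> \<open>\<open>S\<close> is congruent to \<open>c\<close> and also to \<open>c\<close>
    times the number of nonzero digits in \<open>G\<close>. Cancelling the sign shows that this
    number is 1 modulo \<open>m\<close>, and it is less than \<open>m\<close>.\<close>
  then have "[int (card T) * c = c] (mod int m)"
    using c(2) s(2) by (metis cong_scalar_left cong_sym cong_trans sum_constant)
  then have "[int (card T) = 1] (mod int m)"
    using c(1) by (auto simp: cong_minus_minus_iff)
  then have "[card T = 1] (mod m)" by (metis cong_int_iff of_nat_1)
  moreover have "card T < m"
  proof -
    have "card T \<le> card {..<k}" using T by (intro card_mono) auto
    with m(2) show ?thesis by simp
  qed
  ultimately have "card T = 1" using m(3) by (simp add: cong_def)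
  then obtain u where u: "T = {u}" by (auto simp: card_1_singleton_iff)
  show ?thesis
  proof (rule that)
    show "u < k" "G u" using u T(1) by auto
    fix w :: "nat \<Rightarrow> nat" assume w: "\<And>i. \<not> G i \<Longrightarrow> w i = 0"
    have "(\<Sum>i<k. w i * digit m i v) = (\<Sum>i\<in>T. w i * s)"
      using w dig by (intro sum.mono_neutral_cong_right) (fastforce simp: T_def)+
    then show "form m k w v = (w u * s) mod m" by (simp add: form_def u)
  qed (rule s(1))
qed

section \<open>Functional equations on the grid\<close>

text \<open>The position \<open>j\<close> encodes the horizontal offset \<open>j div 2\<close> and
  the sheet \<open>j mod 2\<close>, so the equation looks at \<open>r\<close> consecutive points on
  both sheets. It is used with \<open>r = 1\<close> for the sign conditions and with
  \<open>r = q\<close> for the residues.\<close>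

definition tile_equation ::
    "nat \<Rightarrow> nat \<Rightarrow> (nat \<Rightarrow> nat) \<Rightarrow> nat \<Rightarrow> (int \<times> int \<times> int, nat) equation" where
  "tile_equation m k w r =
     ({v. v < m ^ k \<and> 0 < form m k w v \<and> (form m k w v \<le> r \<or> m - r \<le> form m k w v)},
      map (\<lambda>j. ((int (j div 2), 0, int (j mod 2)), {v. v < m ^ k \<and> form m k w v = 0})) [0..<2 * r])"

text \<open>The shift is (n, -1) because \<open>(i + n, j - 1)\<close> and \<open>(i, j)\<close>
  describe the same cell of column \<open>n\<close>: the number \<open>j * n + i\<close> is
  unchanged.\<close>

definition period_equation ::
    "nat \<Rightarrow> nat \<Rightarrow> (nat \<Rightarrow> nat) \<Rightarrow> nat \<Rightarrow> (int \<times> int \<times> int, nat) equation" where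
  "period_equation m k w n =
     ({v. v < m ^ k},
      [((0, 0, 0), {v. v < m ^ k \<and> form m k w v = 0}),
       ((int n, -1, 0), {v. v < m ^ k \<and> form m k w v \<noteq> 0})])"

lemma carrier_grid_group: "carrier grid_group = UNIV \<times> UNIV \<times> {0..<2}"
  by (simp add: grid_group_def carrier_integer_mod_group integer_group_def)

lemma mult_grid_group:
  "(a, b, c) \<otimes>\<^bsub>grid_group\<^esub> (a', b', c') = (a + a', b + b', (c + c') mod 2)"
  by (simp add: grid_group_def integer_group_def integer_mod_group_def)

lemma group_grid_group: "group grid_group"
  unfolding grid_group_def by (intro DirProd_group group_integer_group group_integer_mod_group)

abbreviation tile_shift :: "int \<times> int \<times> int \<Rightarrow> nat \<Rightarrow> int \<times> int \<times> int" where
  "tile_shift x j \<equiv> x \<otimes>\<^bsub>grid_group\<^esub> (int (j div 2), 0, int (j mod 2))"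

lemma tile_shift_carrier: "x \<in> carrier grid_group \<Longrightarrow> tile_shift x j \<in> carrier grid_group"
  by (cases x) (auto simp: carrier_grid_group mult_grid_group)

lemma solves_equation_cosets:
  assumes "\<And>x j. x \<in> carrier G \<Longrightarrow> j < length ts \<Longrightarrow>
    \<alpha> (x \<otimes>\<^bsub>G\<^esub> fst (ts ! j)) <#\<^bsub>H\<^esub> snd (ts ! j) = A x j"
  shows "solves_equation G H \<alpha> (E', ts) \<longleftrightarrow> (\<forall>x\<in>carrier G.
    (\<forall>i<length ts. \<forall>j<length ts. i \<noteq> j \<longrightarrow> A x i \<inter> A x j = {}) \<and> (\<Union>j<length ts. A x j) = E')"
  unfolding solves_equation_def split Let_def using assms
  by (intro ball_cong refl conj_cong all_cong imp_cong arg_cong[of _ _ "\<lambda>B. B = E'"] SUP_cong)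
    (simp_all del: Union_iff)

text \<open>The translates are fibres of the form, hence disjoint exactly when the form values
  differ. Since \<open>2 * r < m\<close>, the numbers 1, ..., r and their negatives are
  \<open>2 * r\<close> distinct residues, and \<open>2 * r\<close> distinct values among them
  exhaust them.\<close>

lemma solves_tile_equation:
  assumes m: "2 * r < m" and \<beta>: "\<And>x. x \<in> carrier grid_group \<Longrightarrow> \<beta> x < m ^ k"
  shows "solves_equation grid_group (vector_group m k) \<beta> (tile_equation m k w r) \<longleftrightarrow>
    (\<forall>x\<in>carrier grid_group. let F = (\<lambda>j. form m k w (\<beta> (tile_shift x j))) in
       inj_on F {..<2 * r} \<and> (\<forall>j<2 * r. F j \<in> {1..r} \<union> {m - r..<m}))"
proof -
  have m_pos: "0 < m" using m by simp
  let ?R = "{1..r} \<union> {m - r..<m}"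
  let ?F = "\<lambda>x j. form m k w (\<beta> (tile_shift x j))"
  let ?A = "\<lambda>x j. {v. v < m ^ k \<and> form m k w v = ?F x j}"
  have R: "{v. v < m ^ k \<and> 0 < form m k w v \<and> (form m k w v \<le> r \<or> m - r \<le> form m k w v)}
      = {v. v < m ^ k \<and> form m k w v \<in> ?R}"
    using m form_less[OF m_pos, of k w] by (auto simp: Suc_le_eq)
  have cardR: "card ?R = 2 * r" using m by (subst card_Un_disjoint) auto
  have "solves_equation grid_group (vector_group m k) \<beta> (tile_equation m k w r) \<longleftrightarrow>
    (\<forall>x\<in>carrier grid_group. (\<forall>i<2 * r. \<forall>j<2 * r. i \<noteq> j \<longrightarrow> ?A x i \<inter> ?A x j = {}) \<and>
       (\<Union>j<2 * r. ?A x j) = {v. v < m ^ k \<and> form m k w v \<in> ?R})"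
    unfolding tile_equation_def R
    by (subst solves_equation_cosets[where A = ?A])
      (simp_all add: coset_form_zero[OF m_pos \<beta>[OF tile_shift_carrier]])
  also have "\<dots> \<longleftrightarrow> (\<forall>x\<in>carrier grid_group.
      inj_on (?F x) {..<2 * r} \<and> (\<forall>j<2 * r. ?F x j \<in> ?R))"
  proof (rule ball_cong[OF refl])
    fix x assume x: "x \<in> carrier grid_group"
    have mem: "\<beta> (tile_shift x j) < m ^ k" for j by (rule \<beta>[OF tile_shift_carrier[OF x]])
    then have disj: "?A x i \<inter> ?A x j = {} \<longleftrightarrow> ?F x i \<noteq> ?F x j" for i j by auto
    have un: "(\<Union>j<2 * r. ?A x j) = {v. v < m ^ k \<and> form m k w v \<in> ?F x ` {..<2 * r}}" by auto
    have "?F x ` {..<2 * r} = ?R" if "inj_on (?F x) {..<2 * r}" "\<forall>j<2 * r. ?F x j \<in> ?R"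
      using that(2) card_image[OF that(1)] cardR by (intro card_subset_eq) auto
    \<comment> \<open>Every fibre is nonempty, as it contains the value of \<open>\<beta>\<close>
      that defines it; so an equality of unions of fibres gives back the form values.\<close>
    moreover have "?F x j \<in> ?R" if "j < 2 * r"
      "{v. v < m ^ k \<and> form m k w v \<in> ?F x ` {..<2 * r}} = {v. v < m ^ k \<and> form m k w v \<in> ?R}" for j
      using that mem[of j] by blast
    moreover have "(\<forall>i<2 * r. \<forall>j<2 * r. i \<noteq> j \<longrightarrow> ?F x i \<noteq> ?F x j) \<longleftrightarrow> inj_on (?F x) {..<2 * r}"
      unfolding inj_on_def by blast
    ultimately show "((\<forall>i<2 * r. \<forall>j<2 * r. i \<noteq> j \<longrightarrow> ?A x i \<inter> ?A x j = {}) \<and>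
       (\<Union>j<2 * r. ?A x j) = {v. v < m ^ k \<and> form m k w v \<in> ?R}) \<longleftrightarrow>
      (inj_on (?F x) {..<2 * r} \<and> (\<forall>j<2 * r. ?F x j \<in> ?R))"
      unfolding disj un by fast
  qed
  finally show ?thesis by (simp only: Let_def)
qed

lemma solves_period_equation:
  assumes m: "0 < m" and \<beta>: "\<And>x. x \<in> carrier grid_group \<Longrightarrow> \<beta> x < m ^ k"
  shows "solves_equation grid_group (vector_group m k) \<beta> (period_equation m k w n) \<longleftrightarrow>
    (\<forall>x\<in>carrier grid_group. form m k w (\<beta> (x \<otimes>\<^bsub>grid_group\<^esub> (int n, -1, 0))) = form m k w (\<beta> x))"
proof -
  let ?y = "\<lambda>x. x \<otimes>\<^bsub>grid_group\<^esub> (int n, -1, 0)"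
  let ?A = "\<lambda>x (j :: nat). if j = 0 then {v. v < m ^ k \<and> form m k w v = form m k w (\<beta> x)}
      else {v. v < m ^ k \<and> form m k w v \<noteq> form m k w (\<beta> (?y x))}"
  have x0: "x \<otimes>\<^bsub>grid_group\<^esub> (0, 0, 0) = x" and y: "?y x \<in> carrier grid_group"
    if "x \<in> carrier grid_group" for x
    using that by (auto simp: carrier_grid_group mult_grid_group)
  have "solves_equation grid_group (vector_group m k) \<beta> (period_equation m k w n) \<longleftrightarrow>
    (\<forall>x\<in>carrier grid_group. (\<forall>i<2. \<forall>j<2. i \<noteq> j \<longrightarrow> ?A x i \<inter> ?A x j = {}) \<and>
       (\<Union>j<2. ?A x j) = {v. v < m ^ k})"
    unfolding period_equation_def
  proof (subst solves_equation_cosets[where A = ?A], goal_cases)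
    case (1 x j)
    then have "j = 0 \<or> j = 1" by auto
    with 1(1) show ?case
      by (elim disjE)
        (simp_all only: nth_Cons_0 nth_Cons_Suc One_nat_def fst_conv snd_conv x0 if_True if_False
          nat.simps(3) refl coset_form_zero[OF m \<beta>] coset_form_zero[OF m \<beta>[OF y]])
  qed (simp only: list.size add_0_right add_Suc_right numeral_2_eq_2 One_nat_def)
  also have "\<dots> \<longleftrightarrow> (\<forall>x\<in>carrier grid_group. form m k w (\<beta> (?y x)) = form m k w (\<beta> x))"
  proof (rule ball_cong[OF refl])
    fix x assume x: "x \<in> carrier grid_group"
    have two: "(\<forall>i<2. \<forall>j<2. i \<noteq> j \<longrightarrow> B i \<inter> B j = {}) \<longleftrightarrow> B 0 \<inter> B 1 = {}"
      "(\<Union>j<2. B j) = B 0 \<union> B 1" for B :: "nat \<Rightarrow> nat set"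
      by (simp_all add: numeral_2_eq_2 All_less_Suc Int_commute lessThan_Suc Un_commute)
    \<comment> \<open>The element \<open>b\<close> lies in its own fibre, so disjointness from the
      other set forces \<open>f b = d\<close>; conversely a fibre and its complement form a
      partition.\<close>
    have "({v. v < c \<and> f v = f b} \<inter> {v. v < c \<and> f v \<noteq> d} = {} \<and>
        {v. v < c \<and> f v = f b} \<union> {v. v < c \<and> f v \<noteq> d} = {v. v < c}) \<longleftrightarrow> d = f b"
      if "b < c" for f :: "nat \<Rightarrow> nat" and b c d
      using that by auto
    from two[of "?A x"] this[of _ _ "form m k w", OF \<beta>[OF x]]
    show "((\<forall>i<2. \<forall>j<2. i \<noteq> j \<longrightarrow> ?A x i \<inter> ?A x j = {}) \<and> (\<Union>j<2. ?A x j) = {v. v < m ^ k}) \<longleftrightarrow>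
        form m k w (\<beta> (?y x)) = form m k w (\<beta> x)"
      by (simp only: if_True if_False refl one_neq_zero)
  qed
  finally show ?thesis .
qed

text \<open>\<open>m - 1\<close> acts as -1 on representatives: \<open>d * (m - 1)\<close> is
  \<open>m - d\<close> plus \<open>d - 1\<close> multiples of \<open>m\<close>.\<close>

lemma times_sign:
  fixes m :: nat
  assumes "2 < m" "d < m" "s \<in> {1, m - 1}"
  shows "(d * s) mod m = (if s = 1 then d else if d = 0 then 0 else m - d)"
proof (cases "s = 1 \<or> d = 0")
  case False
  then have "d * s = (m - d) + (d - 1) * m"
    using assms by (cases d) (auto simp: diff_mult_distrib2 algebra_simps)
  moreover have "((m - d) + (d - 1) * m) mod m = m - d"
    using False assms by (subst mod_mult_self1, intro mod_less) auto
  ultimately show ?thesis using False by simp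
qed (use assms in auto)

text \<open>A number below \<open>m / 2\<close> and the negative of a positive such number lie in
  different halves of the residues, so absolute value and sign can both be read off.\<close>

lemma times_sign_inject:
  fixes m :: nat
  assumes m: "2 * d < m" "2 * d' < m" "2 < m" and s: "s \<in> {1, m - 1}" "s' \<in> {1, m - 1}"
    and eq: "(d * s) mod m = (d' * s') mod m"
  shows "d = d'" and "0 < d \<Longrightarrow> s = s'"
proof -
  have "d < m" "d' < m" using m by auto
  with eq s m(3) have *: "(if s = 1 then d else if d = 0 then 0 else m - d)
      = (if s' = 1 then d' else if d' = 0 then 0 else m - d')"
    by (simp only: times_sign)
  from * m show "d = d'" by (auto split: if_splits)
  from * m s show "s = s'" if "0 < d" using that by (auto split: if_splits)
qed

section \<open>From one function to a tuple over \<open>unit\<close> without auxiliary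
  components\<close>

definition single :: "nat \<Rightarrow> unit + nat \<Rightarrow> nat" where
  "single v = (\<lambda>i\<in>{Inl ()}. v)"

definition lift_equation :: "('g, nat) equation \<Rightarrow> ('g, unit + nat \<Rightarrow> nat) equation" where
  "lift_equation = (\<lambda>(E', ts). (single ` E', map (\<lambda>(h, E). (h, single ` E)) ts))"

abbreviation lift_group :: "nat monoid \<Rightarrow> (nat \<Rightarrow> nat monoid) \<Rightarrow> (unit + nat \<Rightarrow> nat) monoid" where
  "lift_group H K \<equiv> product_group (UNIV <+> {}) (case_sum (\<lambda>_. H) K)"

lemma Plus_unit: "(UNIV :: unit set) <+> ({} :: nat set) = {Inl ()}"
  by (auto simp: Plus_def)

lemma inj_single: "inj single"
  by (rule injI) (auto simp: single_def dest: fun_cong[of _ _ "Inl ()"])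

lemma carrier_lift_group: "carrier (lift_group H K) = single ` carrier H"
proof -
  have "f = single (f (Inl ()))" if "f \<in> extensional {Inl ()}" for f
    using that by (auto simp: single_def extensional_def)
  then show ?thesis
    unfolding Plus_unit by (auto simp: single_def PiE_def) (auto simp: single_def image_iff)
qed

lemma coset_single: "single a <#\<^bsub>lift_group H K\<^esub> single ` E = single ` (a <#\<^bsub>H\<^esub> E)"
  unfolding l_coset_def Plus_unit by (auto simp: single_def restrict_def cong: if_cong)

text \<open>\<open>single\<close> is injective and compatible with translation, hence preserves
  disjointness and unions. The shifts must lie in the carrier because the lifted function is
  restricted to it.\<close>

lemma solves_lift_equation:
  assumes G: "monoid G" and h: "\<And>h E. (h, E) \<in> set ts \<Longrightarrow> h \<in> carrier G"
  shows "solves_equation G (lift_group H K) (\<lambda>x\<in>carrier G. single (\<beta> x)) (lift_equation (E', ts))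
    \<longleftrightarrow> solves_equation G H \<beta> (E', ts)"
proof -
  interpret monoid G by fact
  define ts' where "ts' = map (\<lambda>(h, E). (h, single ` E)) ts"
  have *: "(\<lambda>x\<in>carrier G. single (\<beta> x)) (x \<otimes>\<^bsub>G\<^esub> fst (ts' ! j)) <#\<^bsub>lift_group H K\<^esub> snd (ts' ! j)
      = single ` (\<beta> (x \<otimes>\<^bsub>G\<^esub> fst (ts ! j)) <#\<^bsub>H\<^esub> snd (ts ! j))"
    if "x \<in> carrier G" "j < length ts" for x j
  proof -
    obtain g E where gE: "ts ! j = (g, E)" by fastforce
    with h that have "g \<in> carrier G" by (metis nth_mem)
    with gE that show ?thesis by (simp add: ts'_def coset_single)
  qed
  have disj: "single ` A \<inter> single ` B = {} \<longleftrightarrow> A \<inter> B = {}" for A B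
    by (simp add: image_Int[OF inj_single, symmetric])
  have union: "(\<Union>j<l. single ` A j) = single ` B \<longleftrightarrow> (\<Union>j<l. A j) = B" for A B and l :: nat
    by (simp add: image_UN[symmetric] inj_image_eq_iff[OF inj_single])
  show ?thesis
    unfolding solves_equation_def lift_equation_def split Let_def ts'_def[symmetric]
  proof (rule ball_cong[OF refl])
    fix x assume x: "x \<in> carrier G"
    let ?A = "\<lambda>j. \<beta> (x \<otimes>\<^bsub>G\<^esub> fst (ts ! j)) <#\<^bsub>H\<^esub> snd (ts ! j)"
      and ?B = "\<lambda>j. (\<lambda>x\<in>carrier G. single (\<beta> x)) (x \<otimes>\<^bsub>G\<^esub> fst (ts' ! j)) <#\<^bsub>lift_group H K\<^esub> snd (ts' ! j)"
    have "length ts' = length ts" by (simp add: ts'_def)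
    moreover have "(\<Union>j<length ts. ?B j) = (\<Union>j<length ts. single ` ?A j)"
      by (rule SUP_cong) (auto simp only: lessThan_iff *[OF x])
    moreover have "?B i \<inter> ?B j = {} \<longleftrightarrow> ?A i \<inter> ?A j = {}" if "i < length ts" "j < length ts" for i j
      by (simp only: *[OF x] that disj)
    ultimately show "((\<forall>i<length ts'. \<forall>j<length ts'. i \<noteq> j \<longrightarrow> ?B i \<inter> ?B j = {}) \<and>
         (\<Union>j<length ts'. ?B j) = single ` E') \<longleftrightarrow>
        ((\<forall>i<length ts. \<forall>j<length ts. i \<noteq> j \<longrightarrow> ?A i \<inter> ?A j = {}) \<and> (\<Union>j<length ts. ?A j) = E')"
      by (simp only: union) blast
  qed
qed

text \<open>A system defines its own property: \<open>Q\<close> consists of the tuples whose joint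
  function solves it, and \<open>P\<close> of their only components. With no auxiliary indices,
  extending a tuple adds nothing.\<close>

lemma property_of_system:
  assumes sys: "is_system G (lift_group H K) sys"
  obtains P where "is_property G H P"
    "weakly_expressible G UNIV (\<lambda>_ :: unit. H) (singly P)"
    "weakly_expressed_by G UNIV (\<lambda>_ :: unit. H) {} K sys (singly P)"
    "satisfiable P \<longleftrightarrow> (\<exists>\<gamma>\<in>carrier G \<rightarrow>\<^sub>E carrier (lift_group H K).
       \<forall>e\<in>set sys. solves_equation G (lift_group H K) \<gamma> e)"
proof -
  let ?I = "(UNIV :: unit set) <+> ({} :: nat set)" and ?H = "case_sum (\<lambda>_. H) K"
  let ?PG = "lift_group H K"
  let ?sol = "\<lambda>\<gamma>. \<forall>e\<in>set sys. solves_equation G ?PG \<gamma> e"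
  let ?up = "\<lambda>\<alpha>. \<lambda>i\<in>?I. \<alpha> :: _ \<Rightarrow> nat"
  define Q where "Q = {\<beta> \<in> tuples G ?I ?H. ?sol (joint G ?I \<beta>)}"
  define P where "P = (\<lambda>\<beta>. \<beta> (Inl ())) ` Q"
  have Q: "Q \<subseteq> tuples G ?I ?H" by (auto simp: Q_def)
  have up: "\<beta> = ?up (\<beta> (Inl ()))" if "\<beta> \<in> tuples G ?I ?H" for \<beta>
    using that by (auto simp: tuples_def Plus_unit PiE_def extensional_def)
  have lifts: "lifts_to G UNIV (\<lambda>_. H) (singly P) {} K Q"
    unfolding lifts_to_def
  proof (intro conjI ballI)
    show "singly P \<subseteq> tuples G UNIV (\<lambda>_. H)"
      using Q by (fastforce simp: singly_def P_def tuples_def Plus_unit PiE_iff)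
    show "Q \<subseteq> tuples G (UNIV <+> {}) (case_sum (\<lambda>_. H) K)" by (rule Q)
    show "\<alpha> \<in> singly P \<longleftrightarrow> (\<exists>\<beta>\<in>Q. \<forall>u\<in>UNIV. \<beta> (Inl u) = \<alpha> u)" for \<alpha>
    proof
      assume "\<alpha> \<in> singly P"
      then show "\<exists>\<beta>\<in>Q. \<forall>u\<in>UNIV. \<beta> (Inl u) = \<alpha> u" by (auto simp: singly_def P_def)
    next
      assume "\<exists>\<beta>\<in>Q. \<forall>u\<in>UNIV. \<beta> (Inl u) = \<alpha> u"
      then obtain \<beta> where \<beta>: "\<beta> \<in> Q" "\<And>u. \<beta> (Inl u) = \<alpha> u" by blast
      from \<beta>(2) have "\<alpha> = (\<lambda>_. \<beta> (Inl ()))" by auto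
      with \<beta>(1) show "\<alpha> \<in> singly P" by (simp add: singly_def P_def)
    qed
  qed
  have joint_carrier: "joint G ?I \<beta> \<in> carrier G \<rightarrow>\<^sub>E carrier ?PG" if "\<beta> \<in> tuples G ?I ?H" for \<beta>
    using that by (auto simp: tuples_def joint_def Plus_unit PiE_iff extensional_def)
  \<comment> \<open>Evaluation at the index inverts \<open>joint\<close>, so every solution of the
    system comes from a tuple.\<close>
  have surj: "\<exists>\<beta>\<in>tuples G ?I ?H. joint G ?I \<beta> = \<gamma>" if "\<gamma> \<in> carrier G \<rightarrow>\<^sub>E carrier ?PG" for \<gamma>
  proof
    let ?\<beta> = "\<lambda>i\<in>?I. \<lambda>x\<in>carrier G. \<gamma> x i"
    show "?\<beta> \<in> tuples G ?I ?H" using that by (auto simp: tuples_def Plus_unit PiE_iff)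
    show "joint G ?I ?\<beta> = \<gamma>"
    proof (rule extensionalityI[of _ "carrier G"])
      fix x assume x: "x \<in> carrier G"
      then have "\<gamma> x \<in> extensional ?I" using that by (auto simp: PiE_iff)
      with x show "joint G ?I ?\<beta> x = \<gamma> x"
        by (simp add: joint_def extensional_restrict cong: restrict_cong)
    qed (use that in \<open>auto simp: joint_def PiE_iff\<close>)
  qed
  have expr: "expressed_by G ?PG sys (joint G ?I ` Q)"
    unfolding expressed_by_def is_property_def
  proof (intro conjI sys ballI)
    show "joint G ?I ` Q \<subseteq> carrier G \<rightarrow>\<^sub>E carrier ?PG" using joint_carrier Q by blast
    show "\<gamma> \<in> joint G ?I ` Q \<longleftrightarrow> ?sol \<gamma>" if "\<gamma> \<in> carrier G \<rightarrow>\<^sub>E carrier ?PG" for \<gamma>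
      using surj[OF that] by (auto simp: Q_def)
  qed
  show ?thesis
  proof (rule that[of P])
    show "is_property G H P"
      using Q by (fastforce simp: is_property_def P_def tuples_def Plus_unit PiE_iff)
    show "weakly_expressible G UNIV (\<lambda>_ :: unit. H) (singly P)"
      unfolding weakly_expressible_def expressible_def
      by (intro exI[of _ "{}"] exI[of _ K] exI[of _ Q] exI[of _ sys] conjI)
        (use lifts expr in simp_all)
    show "weakly_expressed_by G UNIV (\<lambda>_ :: unit. H) {} K sys (singly P)"
      unfolding weakly_expressed_by_def using lifts expr by auto
    show "satisfiable P \<longleftrightarrow> (\<exists>\<gamma>\<in>carrier G \<rightarrow>\<^sub>E carrier ?PG. ?sol \<gamma>)"
      (is "_ \<longleftrightarrow> ?R")
    proof
      assume "satisfiable P"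
      then show ?R using joint_carrier by (auto simp: satisfiable_def P_def Q_def)
    next
      assume ?R
      then obtain \<gamma> where \<gamma>: "\<gamma> \<in> carrier G \<rightarrow>\<^sub>E carrier ?PG" "?sol \<gamma>" by blast
      with surj[OF \<gamma>(1)] show "satisfiable P" by (auto simp: satisfiable_def P_def Q_def)
    qed
  qed
qed

lemma lift_property:
  fixes G :: "('g, 'b) monoid_scheme"
  assumes G: "monoid G" and sys: "is_system G H sys"
  obtains P where "is_property G H P"
    "weakly_expressible G UNIV (\<lambda>_ :: unit. H) (singly P)"
    "weakly_expressed_by G UNIV (\<lambda>_ :: unit. H) {} K (map lift_equation sys) (singly P)"
    "satisfiable P \<longleftrightarrow> (\<exists>\<beta>. (\<forall>x\<in>carrier G. \<beta> x \<in> carrier H) \<and> (\<forall>e\<in>set sys. solves_equation G H \<beta> e))"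
proof -
  let ?PG = "lift_group H K"
  have h: "h \<in> carrier G" if "(E', ts) \<in> set sys" "(h, E) \<in> set ts" for E' ts h E
    using that sys by (fastforce simp: is_system_def)
  have "is_system G ?PG (map lift_equation sys)"
    unfolding is_system_def carrier_lift_group
  proof (safe, goal_cases)
    case (1 E' ts f)
    with sys show ?case by (fastforce simp: is_system_def lift_equation_def)
  next
    case (2 E' ts h E)
    with sys show ?case by (fastforce simp: is_system_def lift_equation_def)
  next
    case (3 E' ts h E f)
    with sys show ?case by (fastforce simp: is_system_def lift_equation_def)
  qed
  then obtain P where P: "is_property G H P"
    "weakly_expressible G UNIV (\<lambda>_ :: unit. H) (singly P)"
    "weakly_expressed_by G UNIV (\<lambda>_ :: unit. H) {} K (map lift_equation sys) (singly P)"
    and sat: "satisfiable P \<longleftrightarrow> (\<exists>\<gamma>\<in>carrier G \<rightarrow>\<^sub>E carrier ?PG.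
       \<forall>e\<in>set (map lift_equation sys). solves_equation G ?PG \<gamma> e)"
    by (rule property_of_system)
  have sol: "(\<forall>e\<in>set (map lift_equation sys). solves_equation G ?PG (\<lambda>x\<in>carrier G. single (\<beta> x)) e)
      \<longleftrightarrow> (\<forall>e\<in>set sys. solves_equation G H \<beta> e)" for \<beta>
    using solves_lift_equation[OF G] h by fastforce
  have "(\<exists>\<gamma>\<in>carrier G \<rightarrow>\<^sub>E carrier ?PG.
      \<forall>e\<in>set (map lift_equation sys). solves_equation G ?PG \<gamma> e) \<longleftrightarrow>
    (\<exists>\<beta>. (\<forall>x\<in>carrier G. \<beta> x \<in> carrier H) \<and> (\<forall>e\<in>set sys. solves_equation G H \<beta> e))"
    (is "?L \<longleftrightarrow> ?R")
  proof
    assume ?L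
    then obtain \<gamma> where \<gamma>: "\<gamma> \<in> carrier G \<rightarrow>\<^sub>E carrier ?PG"
      "\<forall>e\<in>set (map lift_equation sys). solves_equation G ?PG \<gamma> e" by blast
    \<comment> \<open>The product over one index consists of the values of \<open>single\<close>,
      which allows \<open>\<gamma>\<close> to be pulled back to a function with values in
      \<open>H\<close>.\<close>
    have "\<exists>b. b \<in> carrier H \<and> \<gamma> x = single b" if "x \<in> carrier G" for x
      using PiE_mem[OF \<gamma>(1) that] unfolding carrier_lift_group by blast
    then obtain \<beta> where \<beta>: "\<And>x. x \<in> carrier G \<Longrightarrow> \<beta> x \<in> carrier H \<and> \<gamma> x = single (\<beta> x)" by metis
    have "\<gamma> = (\<lambda>x\<in>carrier G. single (\<beta> x))"
      using \<gamma>(1) \<beta> by (auto simp: PiE_iff extensional_def)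
    then have "\<forall>e\<in>set sys. solves_equation G H \<beta> e" using \<gamma>(2) sol[of \<beta>] by simp
    with \<beta> show ?R by blast
  next
    assume ?R
    then obtain \<beta> where "\<forall>x\<in>carrier G. \<beta> x \<in> carrier H" "\<forall>e\<in>set sys. solves_equation G H \<beta> e"
      by blast
    then show ?L
      using sol[of \<beta>] by (intro bexI[of _ "\<lambda>x\<in>carrier G. single (\<beta> x)"]) (simp_all only: carrier_lift_group, auto)
  qed
  with P sat show ?thesis by (intro that) simp_all
qed

section \<open>Sudoku layouts\<close>

text \<open>\<open>c\<close>, the code of the initial condition, also bounds all codes of its pairs;
  base \<open>Suc c\<close> therefore has a digit for each of them.\<close>

definition state :: "nat \<Rightarrow> nat \<Rightarrow> nat \<Rightarrow> nat \<times> nat" where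
  "state c n u = prod_decode (digit (Suc c) n u)"

definition admissible :: "nat \<Rightarrow> nat \<Rightarrow> nat \<Rightarrow> nat \<Rightarrow> bool" where
  "admissible N s c u \<longleftrightarrow> (\<forall>n<N. digit (Suc c) n u \<in> set_decode c) \<and>
     list_encode (map (\<lambda>n. snd (state c n u)) [0..<N]) \<in> set_decode s"

definition state_count :: "nat \<Rightarrow> nat \<Rightarrow> nat" where
  "state_count N c = Suc c ^ N"

text \<open>Odd, so that 2 is invertible, and larger than twice the number of coordinates and twice
  every weight: counts of coordinates do not wrap around, and weights remain distinguishable up to
  sign.\<close>

definition modulus :: "nat \<Rightarrow> nat \<Rightarrow> nat \<Rightarrow> nat" where
  "modulus N q c = Suc (2 * (state_count N c + c + q + 1))"

text \<open>The indicator makes the form vanish on the inadmissible coordinates, about which the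
  selector equations say nothing.\<close>

definition column_weight :: "nat \<Rightarrow> nat \<Rightarrow> nat \<Rightarrow> nat \<Rightarrow> nat \<Rightarrow> nat" where
  "column_weight N s c n u = of_bool (admissible N s c u) * digit (Suc c) n u"

text \<open>The successor moves the residues 0, ..., q - 1 to the nonzero weights 1, ..., q, which
  differ from their negatives.\<close>

definition residue_weight :: "nat \<Rightarrow> nat \<Rightarrow> nat \<Rightarrow> nat \<Rightarrow> nat \<Rightarrow> nat" where
  "residue_weight N s c n u = of_bool (admissible N s c u) * Suc (fst (state c n u))"

text \<open>The selectors run up to \<open>u = k\<close> inclusive: this index is out of range and
  contributes the form -tau, which fixes tau up to sign.\<close>

definition puzzle_system ::
    "nat \<Rightarrow> nat \<Rightarrow> nat \<Rightarrow> nat \<Rightarrow> (int \<times> int \<times> int, nat) equation list" where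
  "puzzle_system N s q c = (let m = modulus N q c; k = state_count N c in
     map (\<lambda>u. tile_equation m k (selector m (admissible N s c) u) 1) [0..<Suc k] @
     map (\<lambda>n. period_equation m k (column_weight N s c n) n) [0..<N] @
     map (\<lambda>n. tile_equation m k (residue_weight N s c n) q) [0..<N])"

definition layout :: "nat \<Rightarrow> nat \<Rightarrow> nat \<Rightarrow> nat \<Rightarrow> (int \<Rightarrow> int \<Rightarrow> nat) \<Rightarrow> bool" where
  "layout N s q c u \<longleftrightarrow>
     (\<forall>i j. u i j < state_count N c \<and> admissible N s c (u i j)) \<and>
     (\<forall>n<N. \<forall>i j. digit (Suc c) n (u (i + int n) (j - 1)) = digit (Suc c) n (u i j)) \<and>
     (\<forall>n<N. \<forall>i j. inj_on (\<lambda>l. fst (state c n (u (i + int l) j))) {..<q})"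

section \<open>Solutions of the system correspond to layouts\<close>

text \<open>Under the relevant forms each \<open>\<beta> x\<close> acts like the sign
  \<open>S x\<close> times the unit vector of an admissible index \<open>U x\<close>. The two sheets
  turn out to carry the same index with opposite signs, so the layout is read off from sheet
  0.\<close>

lemma solvable_imp_layout:
  assumes q: "0 < q" and residue: "\<And>n u. n < N \<Longrightarrow> admissible N s c u \<Longrightarrow> fst (state c n u) < q"
    and \<beta>: "\<And>x. x \<in> carrier grid_group \<Longrightarrow> \<beta> x < modulus N q c ^ state_count N c"
    and sol: "\<And>e. e \<in> set (puzzle_system N s q c) \<Longrightarrow>
      solves_equation grid_group (vector_group (modulus N q c) (state_count N c)) \<beta> e"
  shows "\<exists>u. layout N s q c u"
proof -
  define m k G where "m = modulus N q c" and "k = state_count N c" and "G = admissible N s c"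
  have m: "2 * k < m" "2 * c + 2 < m" "2 * q < m" "odd m" "2 < m"
    by (auto simp: m_def k_def modulus_def)
  note \<beta> = \<beta>[folded m_def k_def]
  have selectors: "solves_equation grid_group (vector_group m k) \<beta> (tile_equation m k (selector m G u) 1)"
    if "u \<le> k" for u
    using that by (intro sol[folded m_def k_def])
      (auto simp: puzzle_system_def Let_def m_def k_def G_def less_Suc_eq_le simp del: upt_Suc)
  have columns: "solves_equation grid_group (vector_group m k) \<beta> (period_equation m k (column_weight N s c n) n)"
    and residues: "solves_equation grid_group (vector_group m k) \<beta> (tile_equation m k (residue_weight N s c n) q)"
    if "n < N" for n
    using that unfolding m_def k_def
    by (auto intro!: sol simp: puzzle_system_def Let_def simp del: upt_Suc)
  define e where "e x = x \<otimes>\<^bsub>grid_group\<^esub> (0 :: int, 0 :: int, 1 :: int)" for x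
  have shift0: "tile_shift x 0 = x" and shift1: "tile_shift x 1 = e x"
    if "x \<in> carrier grid_group" for x
    using that by (auto simp: carrier_grid_group mult_grid_group e_def)
  have eG: "e x \<in> carrier grid_group" if "x \<in> carrier grid_group" for x
    using tile_shift_carrier[OF that, of 1] shift1[OF that] by simp
  have sel: "form m k (selector m G u) (\<beta> x) \<in> {1, m - 1}"
    "form m k (selector m G u) (\<beta> (e x)) \<noteq> form m k (selector m G u) (\<beta> x)"
    if x: "x \<in> carrier grid_group" and "u \<le> k" for x u
  proof -
    have *: "inj_on (\<lambda>j. form m k (selector m G u) (\<beta> (tile_shift x j))) {..<2 * 1}"
      "\<forall>j<2 * 1. form m k (selector m G u) (\<beta> (tile_shift x j)) \<in> {1..1} \<union> {m - 1..<m}"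
      using selectors[OF \<open>u \<le> k\<close>] x m(5) by (simp_all only: solves_tile_equation \<beta> Let_def) auto
    from *(2)[rule_format, of 0] show "form m k (selector m G u) (\<beta> x) \<in> {1, m - 1}"
      using shift0[OF x] by auto
    from *(1) show "form m k (selector m G u) (\<beta> (e x)) \<noteq> form m k (selector m G u) (\<beta> x)"
      unfolding inj_on_def by (metis shift0[OF x] shift1[OF x] lessThan_iff mult_1_right one_less_numeral_iff pos2 semiring_norm(76) zero_neq_one)
  qed
  define rep where "rep x u s \<longleftrightarrow> u < k \<and> G u \<and> s \<in> {1, m - 1} \<and>
      (\<forall>w. (\<forall>i. \<not> G i \<longrightarrow> w i = 0) \<longrightarrow> form m k w (\<beta> x) = (w u * s) mod m)" for x u s
  have "\<exists>u s. rep x u s" if x: "x \<in> carrier grid_group" for x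
  proof -
    have "k < m" "1 < m" using m by simp_all
    then obtain u s where "u < k" "G u" "s \<in> {1, m - 1}"
      "\<And>w. (\<And>i. \<not> G i \<Longrightarrow> w i = 0) \<Longrightarrow> form m k w (\<beta> x) = (w u * s) mod m"
      using unit_vector[OF m(4) _ _ sel(1)[OF x]] by metis
    then have "rep x u s" by (simp add: rep_def)
    then show ?thesis by blast
  qed
  then obtain U S where rep: "\<And>x. x \<in> carrier grid_group \<Longrightarrow> rep x (U x) (S x)" by metis
  have U: "U x < k" "G (U x)" and S: "S x \<in> {1, m - 1}" if "x \<in> carrier grid_group" for x
    using rep[OF that] by (simp_all add: rep_def)
  have form: "form m k w (\<beta> x) = (w (U x) * S x) mod m"
    if "x \<in> carrier grid_group" "\<And>i. \<not> G i \<Longrightarrow> w i = 0" for x w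
    using rep[OF that(1)] that(2) by (simp add: rep_def)
  have form_sel: "form m k (selector m G u) (\<beta> x) = ((if U x = u then 1 else m - 1) * S x) mod m"
    if "x \<in> carrier grid_group" for x u
    using that U(2)[OF that] by (subst form) (auto simp: selector_def)
  \<comment> \<open>At \<open>u = k\<close> the form is -tau, with value \<open>- S\<close> at each
    of the two points; the tile equation makes these values differ.\<close>
  have Se: "S (e x) \<noteq> S x" if "x \<in> carrier grid_group" for x
    using sel(2)[OF that, of k] that eG[OF that] U(1)[of x] U(1)[of "e x"]
    by (auto simp: form_sel)
  have minus: "((m - 1) * r) mod m = (if r = 1 then m - 1 else 1)" if "r \<in> {1, m - 1}" for r
    using times_sign[of m "m - 1" r] that m(5) by auto
  \<comment> \<open>Otherwise the selector of \<open>U x\<close> would have the value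
    \<open>S x\<close> at \<open>x\<close> and \<open>- S (e x) = S x\<close> at \<open>e x\<close>,
    contrary to the tile equation.\<close>
  have Ue: "U (e x) = U x" if x: "x \<in> carrier grid_group" for x
  proof (rule ccontr)
    assume "U (e x) \<noteq> U x"
    then have "form m k (selector m G (U x)) (\<beta> (e x)) = (if S (e x) = 1 then m - 1 else 1)"
      using minus[OF S[OF eG[OF x]]] by (simp add: form_sel eG x)
    also have "\<dots> = S x" using Se[OF x] S[OF x] S[OF eG[OF x]] by auto
    also have "\<dots> = form m k (selector m G (U x)) (\<beta> x)"
      using S[OF x] m(5) by (auto simp: form_sel x)
    finally show False using sel(2)[OF x, of "U x"] U(1)[OF x] by simp
  qed
  have col: "form m k (column_weight N s c n) (\<beta> x) = (digit (Suc c) n (U x) * S x) mod m"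
    and res: "form m k (residue_weight N s c n) (\<beta> x) = (Suc (fst (state c n (U x))) * S x) mod m"
    if "x \<in> carrier grid_group" for x n
    using that U(2)[OF that] by (subst form; simp add: column_weight_def residue_weight_def G_def)+
  let ?x = "\<lambda>i j. (i, j, 0) :: int \<times> int \<times> int"
  have x: "?x i j \<in> carrier grid_group" for i j by (simp add: carrier_grid_group)
  have "layout N s q c (\<lambda>i j. U (?x i j))"
    unfolding layout_def
  proof (intro conjI allI impI)
    fix i j
    show "U (?x i j) < state_count N c" using U(1)[OF x] by (simp add: k_def)
    show "admissible N s c (U (?x i j))" using U(2)[OF x] by (simp add: G_def)
  next
    fix n i j assume n: "n < N"
    have "form m k (column_weight N s c n) (\<beta> (?x (i + int n) (j - 1)))
        = form m k (column_weight N s c n) (\<beta> (?x i j))"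
      using columns[OF n] x[of i j] m(5)
      by (simp add: solves_period_equation \<beta>) (auto dest!: bspec simp: mult_grid_group)
    note eq = this[unfolded col[OF x]]
    have less: "2 * digit (Suc c) n u < m" for u
      using digit_less[of "Suc c" n u] m(2) by simp
    show "digit (Suc c) n (U (?x (i + int n) (j - 1))) = digit (Suc c) n (U (?x i j))"
      \<comment> \<open>The equation identifies the two digits only up to the signs of the two
        points, which the bound on the digits removes.\<close>
      by (rule times_sign_inject(1)[OF less less m(5) S[OF x] S[OF x] eq])
  next
    fix n i j assume n: "n < N"
    let ?F = "\<lambda>l. form m k (residue_weight N s c n) (\<beta> (tile_shift (?x i j) l))"
    have inj: "inj_on ?F {..<2 * q}"
      using residues[OF n] x[of i j] m(3) by (simp only: solves_tile_equation \<beta> Let_def)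
    have F: "?F (2 * l) = (Suc (fst (state c n (U (?x (i + int l) j)))) * S (?x (i + int l) j)) mod m"
      "?F (2 * l + 1) = (Suc (fst (state c n (U (?x (i + int l) j)))) * S (e (?x (i + int l) j))) mod m" for l
    proof -
      have "tile_shift (?x i j) (2 * l) = ?x (i + int l) j"
        "tile_shift (?x i j) (2 * l + 1) = e (?x (i + int l) j)"
        by (simp_all add: mult_grid_group e_def)
      then show "?F (2 * l) = (Suc (fst (state c n (U (?x (i + int l) j)))) * S (?x (i + int l) j)) mod m"
        "?F (2 * l + 1) = (Suc (fst (state c n (U (?x (i + int l) j)))) * S (e (?x (i + int l) j))) mod m"
        by (simp_all only: res x eG Ue)
    qed
    show "inj_on (\<lambda>l. fst (state c n (U (?x (i + int l) j)))) {..<q}"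
    proof (rule inj_onI)
      fix l l' assume l: "l \<in> {..<q}" "l' \<in> {..<q}"
        and eq: "fst (state c n (U (?x (i + int l) j))) = fst (state c n (U (?x (i + int l') j)))"
      \<comment> \<open>Both signs occur above the point with offset \<open>l'\<close>, so one of
        its sheets agrees in sign with sheet 0 at offset \<open>l\<close>. Equal residues then give
        equal form values, and injectivity together with parity leaves
        \<open>l = l'\<close>.\<close>
      have "S (?x (i + int l) j) = S (?x (i + int l') j) \<or> S (?x (i + int l) j) = S (e (?x (i + int l') j))"
        using S[OF x, of "i + int l" j] S[OF x, of "i + int l'" j]
          S[OF eG[OF x], of "i + int l'" j] Se[OF x, of "i + int l'" j] by auto
      then have "?F (2 * l) = ?F (2 * l') \<or> ?F (2 * l) = ?F (2 * l' + 1)"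
        unfolding F eq by metis
      then have "2 * l = 2 * l' \<or> 2 * l = 2 * l' + 1"
        using inj_on_eq_iff[OF inj, of "2 * l" "2 * l'"] inj_on_eq_iff[OF inj, of "2 * l" "2 * l' + 1"] l
        by (simp only: lessThan_iff)
      then show "l = l'" by presburger
    qed
  qed
  then show ?thesis by blast
qed

text \<open>The converse construction: \<open>\<beta>\<close> is the unit vector of
  \<open>u i j\<close>, with sign 1 on sheet 0 and -1 on the other sheet.\<close>

lemma layout_imp_solvable:
  assumes u: "layout N s q c u"
    and residue: "\<And>n u. n < N \<Longrightarrow> admissible N s c u \<Longrightarrow> fst (state c n u) < q"
  obtains \<beta> where "\<And>x. x \<in> carrier grid_group \<Longrightarrow> \<beta> x < modulus N q c ^ state_count N c"
    "\<And>e. e \<in> set (puzzle_system N s q c) \<Longrightarrow>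
      solves_equation grid_group (vector_group (modulus N q c) (state_count N c)) \<beta> e"
proof -
  define m k G where "m = modulus N q c" and "k = state_count N c" and "G = admissible N s c"
  have m: "2 * k < m" "2 * c + 2 < m" "2 * q < m" "odd m" "2 < m"
    by (auto simp: m_def k_def modulus_def)
  have u1: "u i j < k" "G (u i j)" for i j using u by (auto simp: layout_def k_def G_def)
  have u2: "digit (Suc c) n (u (i + int n) (j - 1)) = digit (Suc c) n (u i j)"
    and u3: "inj_on (\<lambda>l. fst (state c n (u (i + int l) j))) {..<q}" if "n < N" for n i j
    using u that by (auto simp: layout_def)
  define sg where "sg a = (if a = (0 :: int) then 1 else m - 1)" for a
  have sg: "sg a \<in> {1, m - 1}" "sg a < m" for a using m(5) by (auto simp: sg_def)
  define \<beta> where "\<beta> = (\<lambda>(i, j, a). vector m k (\<lambda>t. if t = u i j then sg a else 0))"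
  have \<beta>: "\<beta> x < m ^ k" for x
    using form_vector_unit(1)[of m "u i j" k "sg a" for i j a] m(5) u1(1) sg(2)
    by (cases x) (simp add: \<beta>_def)
  have form: "form m k w (\<beta> (i, j, a)) = (w (u i j) * sg a) mod m" for w i j a
    using form_vector_unit(2)[of m "u i j" k "sg a" w] m(5) u1(1) sg(2) by (simp add: \<beta>_def)
  \<comment> \<open>Common reduction of both kinds of tile equations: the weights must lie among the
    residues 1, ..., r and their negatives, a set closed under change of sign, and the signed
    weights at the \<open>2 * r\<close> positions must be distinct.\<close>
  have tile: "solves_equation grid_group (vector_group m k) \<beta> (tile_equation m k w r)"
    if r: "2 * r < m" and w: "\<And>i j l. l < r \<Longrightarrow> w (u (i + int l) j) \<in> {1..r} \<union> {m - r..<m}"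
      and inj: "\<And>a i j. inj_on (\<lambda>l. (w (u (i + int (l div 2)) j) * sg ((a + int (l mod 2)) mod 2)) mod m) {..<2 * r}"
    for w r
    unfolding solves_tile_equation[OF r \<beta>] Let_def
  proof (intro ballI conjI allI impI)
    fix x assume x: "x \<in> carrier grid_group"
    then obtain i j a where [simp]: "x = (i, j, a)" by (cases x)
    have F: "form m k w (\<beta> (tile_shift x l)) = (w (u (i + int (l div 2)) j) * sg ((a + int (l mod 2)) mod 2)) mod m" for l
      by (simp add: mult_grid_group form)
    show "inj_on (\<lambda>l. form m k w (\<beta> (tile_shift x l))) {..<2 * r}" unfolding F by (rule inj)
    fix l assume "l < 2 * r"
    then have "w (u (i + int (l div 2)) j) \<in> {1..r} \<union> {m - r..<m}" by (intro w) auto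
    moreover have "(d * t) mod m \<in> {1..r} \<union> {m - r..<m}"
      if d: "d \<in> {1..r} \<union> {m - r..<m}" and t: "t \<in> {1, m - 1}" for d t
    proof -
      have "0 < d" "d < m" using d r by auto
      then have "(d * t) mod m = (if t = 1 then d else m - d)" using times_sign[OF m(5) _ t] by simp
      then show ?thesis using d r by auto
    qed
    ultimately show "form m k w (\<beta> (tile_shift x l)) \<in> {1..r} \<union> {m - r..<m}"
      unfolding F using sg(1) by blast
  qed
  \<comment> \<open>A position is determined by its offset and its sign: adding the fixed sheet
    \<open>a\<close> modulo 2 only permutes the two sheets.\<close>
  have split: "l = l'" if "l div 2 = l' div 2" "sg ((a + int (l mod 2)) mod 2) = sg ((a + int (l' mod 2)) mod 2)" for l l' a
  proof -
    have "(a + int (l mod 2)) mod 2 = (a + int (l' mod 2)) mod 2"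
      using that(2) m(5) by (auto simp: sg_def split: if_splits)
    then have "[int (l mod 2) = int (l' mod 2)] (mod 2)"
      by (metis cong_add_lcancel cong_def)
    then have "l mod 2 = l' mod 2" by (simp add: cong_def flip: of_nat_mod)
    with that(1) show ?thesis by (metis div_mult_mod_eq)
  qed
  show ?thesis
  proof (rule that[of \<beta>, folded m_def k_def])
    show "\<beta> x < m ^ k" for x by (rule \<beta>)
    fix e assume "e \<in> set (puzzle_system N s q c)"
    then consider v where "e = tile_equation m k (selector m G v) 1"
      | n where "n < N" "e = period_equation m k (column_weight N s c n) n"
      | n where "n < N" "e = tile_equation m k (residue_weight N s c n) q"
      by (auto simp: puzzle_system_def Let_def m_def k_def G_def simp del: upt_Suc)
    then show "solves_equation grid_group (vector_group m k) \<beta> e"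
    proof cases
      case 1
      have w: "selector m G v (u i j) \<in> {1, m - 1}" for i j
        using u1 by (simp add: selector_def)
      show ?thesis unfolding 1
      proof (rule tile)
        show "inj_on (\<lambda>l. (selector m G v (u (i + int (l div 2)) j) * sg ((a + int (l mod 2)) mod 2)) mod m) {..<2 * 1}" for a i j
        proof (rule inj_onI, rule split)
          fix l l' :: nat assume l: "l \<in> {..<2 * 1}" "l' \<in> {..<2 * 1}"
          \<comment> \<open>With \<open>r = 1\<close> only the offset 0 occurs; the weight is the
            same at both positions and only the signs are to be compared.\<close>
          then show div: "l div 2 = l' div 2" by simp
          assume "(selector m G v (u (i + int (l div 2)) j) * sg ((a + int (l mod 2)) mod 2)) mod m
            = (selector m G v (u (i + int (l' div 2)) j) * sg ((a + int (l' mod 2)) mod 2)) mod m"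
          moreover have "t = t'" if eq: "(d * t) mod m = (d * t') mod m" and d: "d \<in> {1, m - 1}"
            and t: "t \<in> {1, m - 1}" and t': "t' \<in> {1, m - 1}" for d t t'
          proof -
            have "0 < d" "d < m" using d m(5) by auto
            then have "(d * t) mod m = (if t = 1 then d else m - d)" if "t \<in> {1, m - 1}" for t
              using times_sign[OF m(5) _ that, of d] by simp
            from this[OF t] this[OF t'] eq
            have "(if t = 1 then d else m - d) = (if t' = 1 then d else m - d)" by simp
            \<comment> \<open>No number equals its negative modulo the odd \<open>m\<close> here, so
              the sign of a selector value is visible.\<close>
            moreover have "d \<noteq> m - d" using \<open>0 < d\<close> \<open>d < m\<close> m(4) by presburger
            ultimately show ?thesis using t t' by (auto split: if_splits)
          qed
          ultimately show "sg ((a + int (l mod 2)) mod 2) = sg ((a + int (l' mod 2)) mod 2)"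
            unfolding div using w sg(1) by blast
        qed
        show "selector m G v (u (i + int l) j) \<in> {1..1} \<union> {m - 1..<m}" for i j l
          using w[of "i + int l" j] m(5) by auto
      qed (use m(5) in simp)
    next
      case 2
      have "form m k (column_weight N s c n) (\<beta> (x \<otimes>\<^bsub>grid_group\<^esub> (int n, - 1, 0)))
          = form m k (column_weight N s c n) (\<beta> x)" if x: "x \<in> carrier grid_group" for x
      proof -
        from x obtain i j a where [simp]: "x = (i, j, a)" "a mod 2 = a"
          by (auto simp: carrier_grid_group)
        show ?thesis
          using u2[OF 2(1), of i j] u1(2) by (simp add: mult_grid_group form column_weight_def G_def)
      qed
      then show ?thesis unfolding 2(2) using m(5) by (simp add: solves_period_equation \<beta>)
    next
      case 3
      have w: "residue_weight N s c n (u i j) = Suc (fst (state c n (u i j)))"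
        "fst (state c n (u i j)) < q" for i j
        using u1(2)[of i j] residue[OF 3(1), of "u i j"] by (simp_all add: residue_weight_def G_def)
      show ?thesis unfolding 3(2)
      proof (rule tile)
        show "inj_on (\<lambda>l. (residue_weight N s c n (u (i + int (l div 2)) j) * sg ((a + int (l mod 2)) mod 2)) mod m) {..<2 * q}" for a i j
        proof (rule inj_onI, rule split)
          fix l l' :: nat assume l: "l \<in> {..<2 * q}" "l' \<in> {..<2 * q}"
            and eq: "(residue_weight N s c n (u (i + int (l div 2)) j) * sg ((a + int (l mod 2)) mod 2)) mod m
            = (residue_weight N s c n (u (i + int (l' div 2)) j) * sg ((a + int (l' mod 2)) mod 2)) mod m"
          have less: "2 * Suc (fst (state c n (u i' j))) < m" for i'
            using w(2)[of i' j] m(3) by simp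
          \<comment> \<open>The weights are positive and below \<open>m / 2\<close>, so equal signed
            weights have the same sign and the same residue; the layout then separates the
            offsets.\<close>
          note inject = times_sign_inject[OF less less m(5) sg(1) sg(1) eq[unfolded w(1)]]
          show "sg ((a + int (l mod 2)) mod 2) = sg ((a + int (l' mod 2)) mod 2)"
            by (rule inject(2)) simp
          have "fst (state c n (u (i + int (l div 2)) j)) = fst (state c n (u (i + int (l' div 2)) j))"
            using inject(1) by simp
          then show "l div 2 = l' div 2"
            by (rule inj_onD[OF u3[OF 3(1)]]) (use l in auto)
        qed
        show "residue_weight N s c n (u (i + int l) j) \<in> {1..q} \<union> {m - q..<m}" for i j l
          using w(2)[of "i + int l" j] by (simp add: w(1) Suc_leI)
      qed (rule m(3))
    qed
  qed
qed

section \<open>Layouts correspond to solutions of the puzzle\<close>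

definition rule_code :: "nat \<Rightarrow> (nat \<Rightarrow> nat) set \<Rightarrow> nat" where
  "rule_code N S = set_encode ((\<lambda>f. list_encode (map f [0..<N])) ` S)"

definition condition_code :: "(int \<times> nat) set \<Rightarrow> nat" where
  "condition_code C = set_encode ((\<lambda>(i, s). prod_encode (nat i, s)) ` C)"

text \<open>Set codes are sums of powers of 2, and \<open>x < 2 ^ x\<close>. This is what makes each
  pair of the initial condition a digit in base \<open>Suc c\<close>.\<close>

lemma set_decode_less: "x \<in> set_decode c \<Longrightarrow> x < Suc c"
proof -
  assume "x \<in> set_decode c"
  then have "0 < c div 2 ^ x" by (auto simp: set_decode_def intro: Nat.gr0I)
  then have "2 ^ x \<le> c" by (simp add: div_greater_zero_iff)
  moreover have "x < 2 ^ x" by (rule less_exp)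
  ultimately show ?thesis by linarith
qed

lemma set_decode_condition_code:
  assumes \<Sigma>: "finite \<Sigma>" and C: "initial_condition q \<Sigma> C"
  shows "prod_encode (r, a) \<in> set_decode (condition_code C) \<longleftrightarrow> (int r, a) \<in> C"
proof -
  have sub: "C \<subseteq> {0..<int q} \<times> \<Sigma>" using C by (simp add: initial_condition_def)
  then have "finite C" by (rule finite_subset) (simp add: \<Sigma>)
  moreover have "prod_encode (r, a) \<in> (\<lambda>(i, s). prod_encode (nat i, s)) ` C \<longleftrightarrow> (int r, a) \<in> C"
    using sub by (force simp: image_iff)
  ultimately show ?thesis by (simp add: condition_code_def)
qed

text \<open>The members of \<open>S\<close> are extensional on \<open>{0..<N}\<close>, hence
  determined by their lists of values.\<close>

lemma set_decode_rule_code: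
  assumes \<Sigma>: "finite \<Sigma>" and S: "sudoku_rule N \<Sigma> S"
  shows "list_encode (map f [0..<N]) \<in> set_decode (rule_code N S) \<longleftrightarrow> restrict f {0..<N} \<in> S"
proof -
  have sub: "S \<subseteq> ({0..<N} \<rightarrow>\<^sub>E \<Sigma>)" using S by (simp add: sudoku_rule_def)
  then have "finite S" by (rule finite_subset) (simp add: finite_PiE \<Sigma>)
  moreover have "list_encode (map f [0..<N]) \<in> (\<lambda>f. list_encode (map f [0..<N])) ` S
      \<longleftrightarrow> restrict f {0..<N} \<in> S"
  proof
    assume "list_encode (map f [0..<N]) \<in> (\<lambda>f. list_encode (map f [0..<N])) ` S"
    then obtain g where g: "g \<in> S" "map f [0..<N] = map g [0..<N]" by (auto simp: list_encode_eq)
    have "restrict f {0..<N} = g"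
      using g sub by (intro extensionalityI[of _ "{0..<N}"]) (auto simp: PiE_iff)
    with g show "restrict f {0..<N} \<in> S" by simp
  qed (auto simp: image_iff list_encode_eq intro!: bexI[of _ "restrict f {0..<N}"])
  ultimately show ?thesis by (simp add: rule_code_def)
qed

lemma admissible_code:
  assumes "finite \<Sigma>" "sudoku_rule N \<Sigma> S" "initial_condition q \<Sigma> C"
  defines "c \<equiv> condition_code C"
  shows "admissible N (rule_code N S) c u \<longleftrightarrow>
    (\<forall>n<N. (int (fst (state c n u)), snd (state c n u)) \<in> C) \<and>
    (\<lambda>n\<in>{0..<N}. snd (state c n u)) \<in> S"
proof -
  have "digit (Suc c) n u \<in> set_decode c \<longleftrightarrow> (int (fst (state c n u)), snd (state c n u)) \<in> C" for n
    using set_decode_condition_code[OF assms(1,3), of "fst (state c n u)" "snd (state c n u)"]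
    by (simp add: state_def c_def)
  then show ?thesis
    unfolding admissible_def set_decode_rule_code[OF assms(1,2)] by simp
qed

text \<open>Entry \<open>n\<close> at \<open>(i, j)\<close> records the pair for the cell
  \<open>m = j * n + i\<close>. It depends on \<open>m\<close> alone, which gives the invariance;
  \<open>q\<close> consecutive numbers are incongruent modulo \<open>q\<close> and the permutation
  is injective, which gives distinct residues.\<close>

lemma solvable_imp_layout_code:
  assumes \<Sigma>: "finite \<Sigma>" and S: "sudoku_rule N \<Sigma> S" and C: "initial_condition q \<Sigma> C"
    and sol: "sudoku_solvable N \<Sigma> S q C"
  shows "\<exists>u. layout N (rule_code N S) q (condition_code C) u"
proof -
  define c where "c = condition_code C"
  have q: "0 < q" using C by (simp add: initial_condition_def)
  from sol obtain F where F: "\<And>j i. (\<lambda>n\<in>{0..<N}. F (n, j * int n + i)) \<in> S" and ob: "obeys N q C F"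
    by (auto simp: sudoku_solvable_def sudoku_solution_def)
  from ob have "\<forall>n\<in>{0..<N}. \<exists>\<sigma>. \<sigma> permutes {0..<int q} \<and> (\<forall>m. (\<sigma> (m mod int q), F (n, m)) \<in> C)"
    by (simp only: obeys_def)
  then obtain \<sigma> where "\<forall>n\<in>{0..<N}. \<sigma> n permutes {0..<int q} \<and> (\<forall>m. (\<sigma> n (m mod int q), F (n, m)) \<in> C)"
    by (auto dest: bchoice)
  then have perm: "\<sigma> n permutes {0..<int q}" and \<sigma>C: "(\<sigma> n (m mod int q), F (n, m)) \<in> C"
    if "n < N" for n m using that by auto
  have \<sigma>: "\<sigma> n (m mod int q) \<in> {0..<int q}" if "n < N" for n m
    using \<sigma>C[OF that, of m] C by (auto simp: initial_condition_def)
  define p where "p i j n = prod_encode (nat (\<sigma> n ((j * int n + i) mod int q)), F (n, j * int n + i))" for i j n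
  define u where "u i j = vector (Suc c) N (p i j)" for i j
  have "p i j n \<in> set_decode c" if "n < N" for i j n
    using \<sigma>C[OF that] \<sigma>[OF that, of "j * int n + i"]
    by (simp add: p_def c_def set_decode_condition_code[OF \<Sigma> C])
  then have p: "p i j n < Suc c" if "n < N" for i j n using that set_decode_less by blast
  have digit: "digit (Suc c) n (u i j) = p i j n" if "n < N" for n i j
    unfolding u_def using p that by (rule digit_vector)
  then have st: "state c n (u i j) = (nat (\<sigma> n ((j * int n + i) mod int q)), F (n, j * int n + i))"
    if "n < N" for n i j using that by (simp add: state_def p_def)
  have "layout N (rule_code N S) q c u"
    unfolding layout_def
  proof (intro conjI allI impI)
    fix i j
    show "u i j < state_count N c" unfolding u_def state_count_def using p by (rule vector_less)
    have "(\<lambda>n\<in>{0..<N}. snd (state c n (u i j))) = (\<lambda>n\<in>{0..<N}. F (n, j * int n + i))"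
      by (rule restrict_ext) (simp add: st)
    then have "(\<lambda>n\<in>{0..<N}. snd (state c n (u i j))) \<in> S" using F by simp
    moreover have "(int (fst (state c n (u i j))), snd (state c n (u i j))) \<in> C" if "n < N" for n
      using that \<sigma>[OF that, of "j * int n + i"] \<sigma>C[OF that] by (simp add: st)
    ultimately show "admissible N (rule_code N S) c (u i j)"
      unfolding c_def admissible_code[OF \<Sigma> S C] by blast
  next
    fix n i j assume "n < N"
    then show "digit (Suc c) n (u (i + int n) (j - 1)) = digit (Suc c) n (u i j)"
      by (simp add: digit p_def algebra_simps)
  next
    fix n i j assume n: "n < N"
    show "inj_on (\<lambda>l. fst (state c n (u (i + int l) j))) {..<q}"
    proof (rule inj_onI)
      fix l l' assume l: "l \<in> {..<q}" "l' \<in> {..<q}"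
        and "fst (state c n (u (i + int l) j)) = fst (state c n (u (i + int l') j))"
      then have "\<sigma> n ((j * int n + (i + int l)) mod int q) = \<sigma> n ((j * int n + (i + int l')) mod int q)"
        using \<sigma>[OF n, of "j * int n + (i + int l)"] \<sigma>[OF n, of "j * int n + (i + int l')"]
        by (simp add: st[OF n] eq_nat_nat_iff)
      then have "(j * int n + (i + int l)) mod int q = (j * int n + (i + int l')) mod int q"
        using permutes_inj[OF perm[OF n]] by (rule injD[rotated])
      then have "[j * int n + i + int l = j * int n + i + int l'] (mod int q)"
        by (simp add: cong_def add.assoc)
      then have "[l = l'] (mod q)" by (simp add: cong_add_lcancel cong_int_iff)
      then show "l = l'" using l by (simp add: cong_def)
    qed
  qed
  then show ?thesis unfolding c_def by blast
qed

text \<open>By invariance every entry can be moved to the row \<open>j = 0\<close>, where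
  \<open>F\<close> is read off. A sequence of residues below \<open>q\<close> that is injective on
  every window of length \<open>q\<close> has period \<open>q\<close>, and one period of it is the
  permutation.\<close>

lemma layout_code_imp_solvable:
  assumes \<Sigma>: "finite \<Sigma>" and S: "sudoku_rule N \<Sigma> S" and C: "initial_condition q \<Sigma> C"
    and layout: "layout N (rule_code N S) q (condition_code C) u"
  shows "sudoku_solvable N \<Sigma> S q C"
proof -
  define c where "c = condition_code C"
  have q: "0 < q" and C': "C \<subseteq> {0..<int q} \<times> \<Sigma>" using C by (auto simp: initial_condition_def)
  have adm: "admissible N (rule_code N S) c (u i j)" for i j
    using layout by (simp add: layout_def c_def)
  have uC: "(int (fst (state c n (u i j))), snd (state c n (u i j))) \<in> C" if "n < N" for n i j
    using adm[of i j] that unfolding c_def admissible_code[OF \<Sigma> S C] by blast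
  have uS: "(\<lambda>n\<in>{0..<N}. snd (state c n (u i j))) \<in> S" for i j
    using adm[of i j] unfolding c_def admissible_code[OF \<Sigma> S C] by blast
  have step: "state c n (u (i + int n) (j - 1)) = state c n (u i j)" if "n < N" for n i j
    using layout that by (simp add: layout_def c_def state_def)
  have inj: "inj_on (\<lambda>l. fst (state c n (u (i + int l) j))) {..<q}" if "n < N" for n i j
    using layout that by (simp add: layout_def c_def)
  have line: "state c n (u i j) = state c n (u (j * int n + i) 0)" if n: "n < N" for n i j
  proof -
    \<comment> \<open>\<open>g\<close> follows the points that describe one and the same cell
      \<open>j * int n + i\<close> of column \<open>n\<close>; it is constant, and
      \<open>j' = 0\<close> is the row used below.\<close>
    define g where "g j' = state c n (u (j * int n + i - j' * int n) j')" for j'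
    have g: "g (j' - 1) = g j'" for j'
      using step[OF n, of "j * int n + i - j' * int n" j'] by (simp add: g_def algebra_simps)
    have "g j = g 0"
    proof (induction j rule: int_induct[where k = 0])
      case (step1 k)
      then show ?case using g[of "k + 1"] by simp
    qed (simp_all add: g)
    then show ?thesis by (simp add: g_def)
  qed
  define F where "F = (\<lambda>(n, m)\<in>board N. snd (state c n (u m 0)))"
  have F: "F (n, m) = snd (state c n (u m 0))" if "n < N" for n m
    using that by (simp add: F_def board_def)
  have "sudoku_solution N \<Sigma> S F"
    unfolding sudoku_solution_def
  proof (intro conjI allI)
    show "F \<in> board N \<rightarrow>\<^sub>E \<Sigma>"
      using uC C' by (force simp: F_def board_def)
    fix j i
    have "(\<lambda>n\<in>{0..<N}. F (n, j * int n + i)) = (\<lambda>n\<in>{0..<N}. snd (state c n (u i j)))"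
      by (rule restrict_ext) (simp add: F line[of _ i j])
    then show "(\<lambda>n\<in>{0..<N}. F (n, j * int n + i)) \<in> S" using uS by simp
  qed
  moreover have "obeys N q C F"
    unfolding obeys_def
  proof
    fix n assume "n \<in> {0..<N}"
    then have n: "n < N" by simp
    define r where "r m = fst (state c n (u m 0))" for m
    have r: "r m < q" "(int (r m), F (n, m)) \<in> C" for m
      using uC[OF n, of m 0] C' by (auto simp: r_def F[OF n])
    have inj: "inj_on (\<lambda>l. r (m + int l)) {..<q}" for m
      using inj[OF n] by (simp add: r_def)
    have surj: "(\<lambda>l. r (m + int l)) ` {..<q} = {..<q}" for m
      using card_image[OF inj] r(1) by (intro card_subset_eq) auto
    have period: "r (m + int q) = r m" for m
    proof -
      have "r (m + int q) \<in> (\<lambda>l. r (m + int l)) ` {..<q}" unfolding surj using r(1) by simp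
      then obtain l where l: "l < q" "r (m + int l) = r (m + int q)" by auto
      \<comment> \<open>A positive \<open>l\<close> would produce the same residue at the offsets
        \<open>l - 1\<close> and \<open>q - 1\<close> of the window that starts at
        \<open>m + 1\<close>, although \<open>l < q\<close>.\<close>
      have "l = 0"
      proof (rule ccontr)
        assume "l \<noteq> 0"
        then have "r (m + 1 + int (l - 1)) = r (m + 1 + int (q - 1))" using l q by (simp add: of_nat_diff)
        then have "l - 1 = q - 1" using inj_onD[OF inj[of "m + 1"], of "l - 1" "q - 1"] l q by simp
        with l \<open>l \<noteq> 0\<close> show False by simp
      qed
      with l show ?thesis by simp
    qed
    have "r (m + k * int q) = r m" for m k
    proof (induction k rule: int_induct[where k = 0])
      case (step1 k)
      then show ?case using period[of "m + k * int q"] by (simp add: algebra_simps)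
    next
      case (step2 k)
      then show ?case using period[of "m + (k - 1) * int q"] by (simp add: algebra_simps)
    qed simp
    from this[of "m mod int q" "m div int q" for m] have r_mod: "r (m mod int q) = r m" for m
      by (simp add: mod_div_mult_eq)
    \<comment> \<open>One period of residues, extended by the identity as \<open>permutes\<close>
      requires.\<close>
    define \<sigma> where "\<sigma> x = (if x \<in> {0..<int q} then int (r x) else x)" for x
    have "inj_on \<sigma> {0..<int q}"
    proof (rule inj_onI)
      fix x y assume xy: "x \<in> {0..<int q}" "y \<in> {0..<int q}" "\<sigma> x = \<sigma> y"
      then have "r (0 + int (nat x)) = r (0 + int (nat y))" by (simp add: \<sigma>_def)
      then have "nat x = nat y" by (rule inj_onD[OF inj]) (use xy in auto)
      with xy show "x = y" by (simp add: eq_nat_nat_iff)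
    qed
    moreover have "\<sigma> ` {0..<int q} \<subseteq> {0..<int q}" using r(1) by (auto simp: \<sigma>_def)
    ultimately have "bij_betw \<sigma> {0..<int q} {0..<int q}"
      by (simp add: bij_betw_def endo_inj_surj)
    then have "\<sigma> permutes {0..<int q}" by (rule bij_imp_permutes) (auto simp: \<sigma>_def)
    moreover have "(\<sigma> (m mod int q), F (n, m)) \<in> C" for m
      using r(2)[of m] q by (simp add: \<sigma>_def r_mod)
    ultimately show "\<exists>\<sigma>. \<sigma> permutes {0..<int q} \<and> (\<forall>m. (\<sigma> (m mod int q), F (n, m)) \<in> C)" by blast
  qed
  ultimately show ?thesis unfolding sudoku_solvable_def by blast
qed

section \<open>Computability of the system\<close>

lemma int_encode_int: "int_encode (int n) = 2 * n"
  by (simp add: int_encode_def sum_encode_def)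

lemma int_encode_minus_one: "int_encode (- 1) = 1"
  by (simp add: int_encode_def sum_encode_def)

text \<open>Turns a set code into a bounded sum with a characteristic function, to which the
  computability rules apply.\<close>

lemma set_encode_sum:
  fixes f :: "nat \<Rightarrow> nat"
  assumes "inj f"
  shows "set_encode (f ` {v. v < b \<and> P v}) = (\<Sum>v<b. of_bool (P v) * 2 ^ f v)"
proof -
  have "set_encode (f ` {v. v < b \<and> P v}) = (\<Sum>v | v < b \<and> P v. 2 ^ f v)"
    unfolding set_encode_def using assms by (subst sum.reindex) (auto intro: inj_on_subset)
  also have "\<dots> = (\<Sum>v<b. of_bool (P v) * 2 ^ f v)"
    by (rule sum.mono_neutral_cong_left) auto
  finally show ?thesis .
qed

text \<open>The code of the one-element list \<open>[v]\<close>, written out arithmetically.\<close>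

definition digit_code :: "nat \<Rightarrow> nat" where
  "digit_code v = Suc (prod_encode (v, 0))"

lemma element_code_single: "element_code 0 (single v) = digit_code v"
  by (simp add: element_code_def single_def digit_code_def)

definition level_code :: "nat \<Rightarrow> (nat \<Rightarrow> bool) \<Rightarrow> nat" where
  "level_code b P = (\<Sum>v<b. of_bool (P v) * 2 ^ digit_code v)"

lemma level_code: "set_encode (element_code 0 ` single ` {v. v < b \<and> P v}) = level_code b P"
proof -
  have "inj digit_code" by (rule injI) (simp add: digit_code_def)
  from set_encode_sum[OF this] show ?thesis
    by (simp add: image_image element_code_single level_code_def)
qed

abbreviation "lifted_code \<equiv> \<lambda>eq. equation_code 0 (lift_equation eq)"

text \<open>Unfolded into pairings, bounded sums and list codes. The factors 2 arise because
  \<open>int_encode\<close> sends a nonnegative integer to its double.\<close>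

lemma tile_code:
  "lifted_code (tile_equation m k w r) = prod_encode
     (level_code (m ^ k) (\<lambda>v. 0 < form m k w v \<and> (form m k w v \<le> r \<or> m - r \<le> form m k w v)),
      list_encode (map (\<lambda>j. prod_encode (prod_encode (2 * (j div 2), prod_encode (0, 2 * (j mod 2))),
        level_code (m ^ k) (\<lambda>v. form m k w v = 0))) [0..<2 * r]))"
proof -
  have "shift_code (int (j div 2), 0, int (j mod 2))
      = prod_encode (2 * (j div 2), prod_encode (0, 2 * (j mod 2)))" for j
    using int_encode_int[of 0] by (simp add: shift_code_def int_encode_int del: of_nat_mod of_nat_div)
  then show ?thesis
    by (simp add: equation_code_def lift_equation_def tile_equation_def level_code comp_def)
qed

text \<open>The two-term list is spelled out by the list constructors; the component -1 of the shift
  has the code 1.\<close>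

lemma period_code:
  "lifted_code (period_equation m k w n) = prod_encode
     (level_code (m ^ k) (\<lambda>v. True),
      Suc (prod_encode (prod_encode (0, level_code (m ^ k) (\<lambda>v. form m k w v = 0)),
        Suc (prod_encode (prod_encode (prod_encode (2 * n, prod_encode (1, 0)),
          level_code (m ^ k) (\<lambda>v. form m k w v \<noteq> 0)), 0)))))"
proof -
  have "shift_code (0, 0, 0) = 0" "shift_code (int n, - 1, 0) = prod_encode (2 * n, prod_encode (1, 0))"
    using int_encode_int[of 0]
    by (simp_all add: shift_code_def int_encode_int int_encode_minus_one prod_encode_def)
  then show ?thesis
    using level_code[of "m ^ k" "\<lambda>_. True"]
    by (simp add: equation_code_def lift_equation_def period_equation_def level_code)
qed

text \<open>Different pairs of factors give different entries of the multiplication graph, so its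
  code is a double sum without collisions.\<close>

lemma group_code_vector_group:
  "group_code (vector_group m k) = (\<Sum>a<m ^ k. \<Sum>b<m ^ k.
     2 ^ prod_encode (a, prod_encode (b, vector m k (\<lambda>i. (digit m i a + digit m i b) mod m))))"
proof -
  let ?f = "\<lambda>(a, b). prod_encode (a, prod_encode (b, a \<otimes>\<^bsub>vector_group m k\<^esub> b))"
  have "inj_on ?f ({..<m ^ k} \<times> {..<m ^ k})" by (auto intro!: inj_onI)
  then have "group_code (vector_group m k) = (\<Sum>p\<in>{..<m ^ k} \<times> {..<m ^ k}. 2 ^ ?f p)"
    unfolding group_code_def carrier_vector_group set_encode_def by (simp add: sum.reindex)
  also have "\<dots> = (\<Sum>a<m ^ k. \<Sum>b<m ^ k. 2 ^ ?f (a, b))"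
    by (subst sum.cartesian_product) (simp add: case_prod_unfold)
  finally show ?thesis by (simp add: mult_vector_group)
qed

section \<open>Algorithms for the codes of the group and of the equations\<close>

lemma computable_digit:
  "computable e m \<Longrightarrow> computable e i \<Longrightarrow> computable e v \<Longrightarrow> computable e (\<lambda>a. digit (m a) (i a) (v a))"
  unfolding digit_def by (intro computable_mod computable_div computable_power)

lemma computable_vector:
  assumes "computable e m" "computable e k" "computable (ext e) (\<lambda>p. d (fst p) (snd p))"
  shows "computable e (\<lambda>a. vector (m a) (k a) (\<lambda>i. d i a))"
  unfolding vector_def using computable_length[OF assms(1)]
  by (intro computable_sum computable_mult computable_power assms computable_snd[OF assms(1)] computable_fst)

lemma computable_form:
  assumes "computable e m" "computable e k" "computable e v"
    "computable (ext e) (\<lambda>p. w (fst p) (snd p))"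
  shows "computable e (\<lambda>a. form (m a) (k a) (\<lambda>i. w i a) (v a))"
  unfolding form_def using computable_length[OF assms(1)]
  by (intro computable_mod computable_sum computable_mult computable_digit assms
      computable_snd[OF assms(1)] computable_snd[OF assms(3)] computable_fst)

text \<open>Here the vector is itself the bound variable, as in sums over the whole group, while the
  coefficients depend on their index and the outer variables only.\<close>

lemma computable_form_ext:
  assumes "computable e m" "computable e k" "computable (ext e) (\<lambda>p. w (fst p) (snd p))"
  shows "computable (ext e) (\<lambda>p. form (m (snd p)) (k (snd p)) (\<lambda>i. w i (snd p)) (fst p))"
  using computable_length[OF assms(1)]
  by (intro computable_form[where w = "\<lambda>i p. w i (snd p)"] computable_snd[OF assms(1)]
      computable_snd[OF assms(2)] computable_fst computable_swap[OF assms(3)])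

lemma computable_level_code:
  assumes "computable e b" "decidable (ext e) (\<lambda>p. P (fst p) (snd p))"
  shows "computable e (\<lambda>a. level_code (b a) (\<lambda>v. P v a))"
  unfolding level_code_def digit_code_def using computable_length[OF assms(1)]
  by (intro computable_sum computable_mult computable_power computable_Suc computable_prod_encode
      assms(2)[unfolded decidable_def] assms(1) computable_basic)

lemma computable_tile_code:
  assumes m: "computable e m" and k: "computable e k" and r: "computable e r"
    and w: "computable (ext e) (\<lambda>p. w (fst p) (snd p))"
  shows "computable e (\<lambda>a. lifted_code (tile_equation (m a) (k a) (\<lambda>i. w i a) (r a)))"
proof -
  have l: "\<exists>l. \<forall>a. length (e a) = l" by (rule computable_length[OF m])
  note form = computable_form_ext[OF m k w]
  have zero: "computable e (\<lambda>a. level_code (m a ^ k a) (\<lambda>v. form (m a) (k a) (\<lambda>i. w i a) v = 0))"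
    by (intro computable_level_code computable_power m k decidable_eq form computable_basic l)
  have full: "computable e (\<lambda>a. level_code (m a ^ k a) (\<lambda>v. 0 < form (m a) (k a) (\<lambda>i. w i a) v \<and>
      (form (m a) (k a) (\<lambda>i. w i a) v \<le> r a \<or> m a - r a \<le> form (m a) (k a) (\<lambda>i. w i a) v)))"
    by (intro computable_level_code computable_power m k decidable_conj decidable_disj decidable_less
        decidable_le form computable_basic l computable_diff computable_snd[OF m] computable_snd[OF r])
  \<comment> \<open>The empty tail gives the list the shape that
    \<open>computable_list_encode\<close> expects.\<close>
  have "computable e (\<lambda>a. list_encode (map (\<lambda>j. prod_encode
        (prod_encode (2 * (j div 2), prod_encode (0, 2 * (j mod 2))),
         level_code (m a ^ k a) (\<lambda>v. form (m a) (k a) (\<lambda>i. w i a) v = 0))) [0..<2 * r a] @ []))"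
    by (intro computable_list_encode computable_prod_encode computable_mult computable_div
        computable_mod computable_snd[OF zero] computable_basic l r)
  with full show ?thesis unfolding tile_code append_Nil2 by (intro computable_prod_encode)
qed

lemma computable_period_code:
  assumes m: "computable e m" and k: "computable e k" and n: "computable e n"
    and w: "computable (ext e) (\<lambda>p. w (fst p) (snd p))"
  shows "computable e (\<lambda>a. lifted_code (period_equation (m a) (k a) (\<lambda>i. w i a) (n a)))"
proof -
  have l: "\<exists>l. \<forall>a. length (e a) = l" by (rule computable_length[OF m])
  note form = computable_form_ext[OF m k w]
  have true: "decidable (ext e) (\<lambda>_. True)"
    using length_ext[THEN iffD2, OF l] by (simp add: decidable_def computable_const)
  show ?thesis
    unfolding period_code
    by (intro computable_prod_encode computable_Suc computable_level_code computable_power m k n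
        decidable_not decidable_eq form computable_basic l computable_mult true)
qed

lemma computable_group_code:
  assumes "computable e m" "computable e k"
  shows "computable e (\<lambda>a. group_code (vector_group (m a) (k a)))"
  unfolding group_code_vector_group using computable_length[OF assms(1)]
  by (intro computable_sum computable_power computable_prod_encode computable_vector computable_mod
      computable_add computable_digit assms computable_basic
      computable_snd[OF computable_snd[OF computable_snd[OF assms(1)]]]
      computable_snd[OF computable_snd[OF assms(1)]] computable_snd[OF computable_snd[OF assms(2)]]
      computable_snd[OF assms(1)] computable_snd[OF assms(2)]
      computable_snd[OF computable_snd[OF computable_fst]] computable_snd[OF computable_fst])

lemma decidable_admissible:
  assumes "computable e N" "computable e s" "computable e c" "computable e u"
  shows "decidable e (\<lambda>a. admissible (N a) (s a) (c a) (u a))"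
proof -
  have l: "\<exists>l. \<forall>a. length (e a) = l" by (rule computable_length[OF assms(1)])
  have dig: "computable (ext e) (\<lambda>p. digit (Suc (c (snd p))) (fst p) (u (snd p)))"
    by (intro computable_digit computable_Suc computable_snd[OF assms(3)] computable_snd[OF assms(4)]
        computable_fst l)
  have "computable e (\<lambda>a. list_encode (map (\<lambda>n. snd (prod_decode (digit (Suc (c a)) n (u a)))) [0..<N a] @ []))"
    by (intro computable_list_encode computable_prod_decode dig assms) (simp add: computable_zero l)
  then show ?thesis
    unfolding admissible_def state_def append_Nil2
    by (intro decidable_conj decidable_all decidable_set_decode dig assms computable_snd[OF assms(3)])
qed

lemma computable_weights:
  assumes "computable e N" "computable e s" "computable e c" "computable e u" "computable e n"
  shows "computable e (\<lambda>a. column_weight (N a) (s a) (c a) (n a) (u a))"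
    and "computable e (\<lambda>a. residue_weight (N a) (s a) (c a) (n a) (u a))"
    and "computable e m \<Longrightarrow> computable e (\<lambda>a. selector (m a) (admissible (N a) (s a) (c a)) (n a) (u a))"
  unfolding column_weight_def residue_weight_def selector_def state_def
  using computable_length[OF assms(1)]
  by (intro computable_mult computable_Suc computable_prod_decode computable_digit computable_if
      decidable_eq computable_diff decidable_admissible[unfolded decidable_def] assms computable_basic)+

lemma computable_puzzle_system:
  assumes N: "computable e N" and s: "computable e s" and q: "computable e q" and c: "computable e c"
  shows "computable e (\<lambda>a. list_encode (map lifted_code (puzzle_system (N a) (s a) (q a) (c a))))"
    and "computable e (\<lambda>a. group_code (vector_group (modulus (N a) (q a) (c a)) (state_count (N a) (c a))))"
proof -
  have l: "\<exists>l. \<forall>a. length (e a) = l" by (rule computable_length[OF N])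
  have k: "computable e (\<lambda>a. state_count (N a) (c a))"
    unfolding state_count_def by (intro computable_power computable_Suc N c)
  have m: "computable e (\<lambda>a. modulus (N a) (q a) (c a))"
    unfolding modulus_def by (intro computable_Suc computable_mult computable_add k c q computable_basic l)
  show "computable e (\<lambda>a. group_code (vector_group (modulus (N a) (q a) (c a)) (state_count (N a) (c a))))"
    by (rule computable_group_code[OF m k])
  note up = computable_snd[OF m] computable_snd[OF k] computable_snd[OF q]
    computable_snd[OF computable_snd[OF N]] computable_snd[OF computable_snd[OF s]]
    computable_snd[OF computable_snd[OF c]] computable_snd[OF computable_snd[OF m]]
    computable_snd[OF computable_fst]
  \<comment> \<open>The three families are concatenated to the right with a final empty list, so
    that the rule for list codes applies three times.\<close>
  have sys: "list_encode (map lifted_code (puzzle_system N s q c)) =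
      list_encode (map (\<lambda>u. lifted_code (tile_equation (modulus N q c) (state_count N c)
          (selector (modulus N q c) (admissible N s c) u) 1)) [0..<Suc (state_count N c)] @
        map (\<lambda>n. lifted_code (period_equation (modulus N q c) (state_count N c)
          (column_weight N s c n) n)) [0..<N] @
        map (\<lambda>n. lifted_code (tile_equation (modulus N q c) (state_count N c)
          (residue_weight N s c n) q)) [0..<N] @ [])" for N s q c
    by (simp add: puzzle_system_def Let_def comp_def del: upt_Suc)
  show "computable e (\<lambda>a. list_encode (map lifted_code (puzzle_system (N a) (s a) (q a) (c a))))"
    unfolding sys
    by (intro computable_list_encode computable_tile_code computable_period_code computable_weights
        computable_Suc up N k computable_basic l)
qed

section \<open>The algorithm and its correctness\<close>

theorem theorem6p4:
  shows "\<exists>A :: algorithm.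
    \<forall>(N :: nat) (\<Sigma> :: nat set) (S :: (nat \<Rightarrow> nat) set) (q :: nat) (C :: (int \<times> nat) set).
      finite \<Sigma> \<and> \<Sigma> \<noteq> {} \<and> sudoku_rule N \<Sigma> S \<and> initial_condition q \<Sigma> C \<longrightarrow>
      (\<exists>(H\<^sub>1 :: nat monoid) (n :: nat) (K :: nat \<Rightarrow> nat monoid)
          (sys :: (int \<times> int \<times> int, unit + nat \<Rightarrow> nat) equation list)
          (P :: (int \<times> int \<times> int \<Rightarrow> nat) set).
        yields A (puzzle_code N \<Sigma> S q C) (output_code H\<^sub>1 n K sys) \<and>
        finite_abelian H\<^sub>1 \<and>
        is_property grid_group H\<^sub>1 P \<and>
        weakly_expressible grid_group UNIV (\<lambda>_ :: unit. H\<^sub>1) (singly P) \<and>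
        weakly_expressed_by grid_group UNIV (\<lambda>_ :: unit. H\<^sub>1) {0..<n} K sys (singly P) \<and>
        (sudoku_solvable N \<Sigma> S q C \<longleftrightarrow> satisfiable P))"
proof -
  define e where "e = (\<lambda>(N, s, q, c, \<sigma>). [N, \<sigma>, s, q, c :: nat])"
  have e: "length (e a) = 5" for a by (simp add: e_def case_prod_unfold)
  then have l: "\<exists>l. \<forall>a. length (e a) = l" by blast
  define N s q c where "N = (\<lambda>a. e a ! 0)" and "s = (\<lambda>a. e a ! 2)" and "q = (\<lambda>a. e a ! 3)"
    and "c = (\<lambda>a. e a ! 4)"
  have comp: "computable e N" "computable e s" "computable e q" "computable e c"
    unfolding N_def s_def q_def c_def by (rule computable_nth[OF e], simp)+
  \<comment> \<open>The component 0 is the code of the empty list of auxiliary groups.\<close>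
  have "computable e (\<lambda>a. prod_encode
      (group_code (vector_group (modulus (N a) (q a) (c a)) (state_count (N a) (c a))),
       prod_encode (0, list_encode (map lifted_code (puzzle_system (N a) (s a) (q a) (c a))))))"
    by (intro computable_prod_encode computable_puzzle_system[OF comp] computable_zero l)
  then obtain A where "yields A (e a) (prod_encode
      (group_code (vector_group (modulus (N a) (q a) (c a)) (state_count (N a) (c a))),
       prod_encode (0, list_encode (map lifted_code (puzzle_system (N a) (s a) (q a) (c a))))))" for a
    unfolding computable_def by blast
  from this[of "(N, s, q, c, \<sigma>)" for N s q c \<sigma>]
  have A: "yields A [N, \<sigma>, s, q, c] (prod_encode
      (group_code (vector_group (modulus N q c) (state_count N c)),
       prod_encode (0, list_encode (map lifted_code (puzzle_system N s q c)))))" for N s q c \<sigma>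
    by (simp add: e_def N_def s_def q_def c_def)
  show ?thesis
  proof (intro exI[of _ A] allI impI, elim conjE)
    fix N \<Sigma> S q C
    assume \<Sigma>: "finite (\<Sigma> :: nat set)" and S: "sudoku_rule N \<Sigma> S" and C: "initial_condition q \<Sigma> C"
    define s c where "s = rule_code N S" and "c = condition_code C"
    define H where "H = vector_group (modulus N q c) (state_count N c)"
    define sys where "sys = puzzle_system N s q c"
    have q: "0 < q" using C by (simp add: initial_condition_def)
    \<comment> \<open>Admissible states have their pairs in \<open>C\<close>, whose first components
      lie below \<open>q\<close>; both directions between systems and layouts rest on this
      bound.\<close>
    have residue: "fst (state c n u) < q" if "n < N" "admissible N s c u" for n u
    proof -
      from that have "(int (fst (state c n u)), snd (state c n u)) \<in> C"
        unfolding s_def c_def admissible_code[OF \<Sigma> S C] by blast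
      with C show ?thesis by (auto simp: initial_condition_def)
    qed
    have carrier: "carrier H = {..<modulus N q c ^ state_count N c}" by (simp add: H_def)
    have "is_system grid_group H sys"
      unfolding is_system_def sys_def puzzle_system_def Let_def carrier
      by (auto simp: tile_equation_def period_equation_def carrier_grid_group)
    then obtain P where P: "is_property grid_group H P"
      "weakly_expressible grid_group UNIV (\<lambda>_ :: unit. H) (singly P)"
      "weakly_expressed_by grid_group UNIV (\<lambda>_ :: unit. H) {} (\<lambda>_. H) (map lift_equation sys) (singly P)"
      and sat: "satisfiable P \<longleftrightarrow> (\<exists>\<beta>. (\<forall>x\<in>carrier grid_group. \<beta> x \<in> carrier H) \<and>
        (\<forall>e\<in>set sys. solves_equation grid_group H \<beta> e))"
      by (rule lift_property[OF group.is_monoid[OF group_grid_group], where K = "\<lambda>_. H"])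
    \<comment> \<open>Layouts mediate between the two sides: first between the system and layouts,
      then between layouts and the puzzle.\<close>
    have "satisfiable P \<longleftrightarrow> (\<exists>u. layout N s q c u)"
    proof
      assume "satisfiable P"
      then obtain \<beta> where \<beta>: "\<And>x. x \<in> carrier grid_group \<Longrightarrow> \<beta> x \<in> carrier H"
        "\<And>e. e \<in> set sys \<Longrightarrow> solves_equation grid_group H \<beta> e"
        unfolding sat by blast
      then show "\<exists>u. layout N s q c u"
        by (intro solvable_imp_layout[OF q residue, where \<beta> = \<beta>]) (simp_all add: carrier sys_def H_def)
    next
      assume "\<exists>u. layout N s q c u"
      then obtain u where "layout N s q c u" by blast
      from layout_imp_solvable[OF this residue]
      obtain \<beta> where "\<And>x. x \<in> carrier grid_group \<Longrightarrow> \<beta> x < modulus N q c ^ state_count N c"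
        "\<And>e. e \<in> set sys \<Longrightarrow> solves_equation grid_group H \<beta> e"
        unfolding sys_def H_def by blast
      then show "satisfiable P" unfolding sat carrier lessThan_iff by blast
    qed
    also have "\<dots> \<longleftrightarrow> sudoku_solvable N \<Sigma> S q C"
      unfolding s_def c_def
      using solvable_imp_layout_code[OF \<Sigma> S C] layout_code_imp_solvable[OF \<Sigma> S C] by blast
    finally have solvable: "sudoku_solvable N \<Sigma> S q C \<longleftrightarrow> satisfiable P" by simp
    have "puzzle_code N \<Sigma> S q C = [N, set_encode \<Sigma>, s, q, c]"
      by (simp add: puzzle_code_def s_def c_def rule_code_def condition_code_def)
    moreover have "output_code H 0 (\<lambda>_. H) (map lift_equation sys)
        = prod_encode (group_code H, prod_encode (0, list_encode (map lifted_code sys)))"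
      by (simp add: output_code_def comp_def)
    ultimately have "yields A (puzzle_code N \<Sigma> S q C) (output_code H 0 (\<lambda>_. H) (map lift_equation sys))"
      using A by (simp add: H_def sys_def)
    moreover have "finite_abelian H"
      unfolding H_def by (rule vector_group) (simp add: modulus_def)
    moreover have "weakly_expressed_by grid_group UNIV (\<lambda>_ :: unit. H) {0..<0} (\<lambda>_. H)
        (map lift_equation sys) (singly P)"
      using P(3) by simp
    ultimately show "\<exists>H\<^sub>1 n K sys P. yields A (puzzle_code N \<Sigma> S q C) (output_code H\<^sub>1 n K sys) \<and>
        finite_abelian H\<^sub>1 \<and> is_property grid_group H\<^sub>1 P \<and>
        weakly_expressible grid_group UNIV (\<lambda>_ :: unit. H\<^sub>1) (singly P) \<and>
        weakly_expressed_by grid_group UNIV (\<lambda>_ :: unit. H\<^sub>1) {0..<n} K sys (singly P) \<and>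
        (sudoku_solvable N \<Sigma> S q C \<longleftrightarrow> satisfiable P)"
      using P(1,2) solvable by blast
  qed
qed

end
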